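(* Let $\mathcal{N}$ be a finite-dimensional stopping model closed under pgf composition, connected, with a non-empty interior, and with $p_i(N)=\Pr(N=i)$ continuously differentiable with respect to the parameters for all $i\ge1$. Let $K_{\mathcal{N}}$ be its Koenigs function and $$\varphi_{\mathcal{N}}(t)=1-\frac{K_{\mathcal{N}}(t)}{tK_{\mathcal{N}}'(t)}.$$ The model can include $N_I$ (that is, it admits the parameter space $(0,1]$ for $\theta=p_1(N)$) if and only if $\varphi_{\mathcal{N}}(t)$ is itself the pgf of a random variable, with $\varphi_{\mathcal{N}}(0)=0$. Consequently, there exists a bijective correspondence between the class of finite-dimensional stopping models that are closed under pgf composition, connected, with a non-empty interior, with $p_i(N)=\Pr(N=i)$ continuously differentiable with respect to the parameters for all $i\ge1$, and with parameter space $(0,1]$ for $\theta=p_1(N)$ (hence including $N_I$), and the set of probability distributions supported on the positive integers.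
   Context: All random variables $N$ here are positive integer-valued ($\Pr(N=0)=0$) with probability generating function (pgf) $h_N(t)=\sum_{i\ge1}p_i(N)t^i$; they are identified with their distributions. $N_I$ is the degenerate variable at one, $h_{N_I}(t)=t$. A stopping model $\mathcal{N}$ is a family of such random variables. It is finite-dimensional if, for some positive integer $m$, it is either globally parametrized by a vector in a parameter space in $\mathbb{R}^m$ that is an open set (possibly with boundary), or it is an $m$-dimensional differentiable manifold (possibly with boundary) embedded in the space of probability sequences. Interior is relative to this $m$-dimensional structure. $\mathcal{N}$ is closed under pgf composition if for all $N_1,N_2\in\mathcal{N}$ the random variable $N_1\circ N_2$ with pgf $h_{N_1}\circ h_{N_2}$ belongs to $\mathcal{N}$. For a model satisfying the hypotheses, all pgfs of elements of $\mathcal{N}$ commute under composition, $p_1(N)>0$ for all $N\in\mathcal{N}$, and the Koenigs function $K_{\mathcal{N}}(t)=\lim_{n\to\infty}h_N^{\circ n}(t)/[h_N'(0)]^n$, $t\in[0,1)$ (where $h_N^{\circ n}$ is the $n$-fold composition), does not depend on the choice of $N\in\mathcal{N}$, $N\ne N_I$; it is analytic on $[0,1)$, with $K_{\mathcal{N}}(0)=0$ and $K_{\mathcal{N}}'(0)=1$. The elements of $\mathcal{N}$ are the random variables $N_\theta$ with pgf $h_{N_\theta}(t)=K_{\mathcal{N}}^{-1}(\theta K_{\mathcal{N}}(t))$, $\theta=p_1(N_\theta)$, for $\theta$ in the parameter space of $\mathcal{N}$. The model "can include $N_I$", or admits the parameter space $(0,1]$, when $K_{\mathcal{N}}^{-1}(\theta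 K_{\mathcal{N}}(t))$ is a pgf for every $\theta\in(0,1]$, so that the model with this Koenigs function can be taken with parameter space $(0,1]$; $\theta=1$ corresponds to $N_I$.
   Formalization: The correspondence sending a model to the law with pgf φ is proved onto exactly the laws with ∫_{1/2}^1 dt/(1−φ(t)) = ∞ (it misses e.g. φ = 1−√(1−t), where K is bounded); a bijection with all distributions on the positive integers is proved only as abstract existence. *)

theory Defs
  imports "HOL-Probability.Probability"
begin

text \<open>
  Random variables are identified with their distributions, i.e. with elements of type
  \<open>nat pmf\<close>; positive integer-valued means no mass at \<open>0\<close>.
\<close>

definition positive_rvs :: "nat pmf set" where
  "positive_rvs = {N. pmf N 0 = 0}"

definition pgf :: "nat pmf \<Rightarrow> real \<Rightarrow> real" where
  "pgf N t = (\<Sum>i. pmf N i * t ^ i)"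

definition N_I :: "nat pmf" where
  "N_I = return_pmf 1"

definition is_pgf :: "(real \<Rightarrow> real) \<Rightarrow> bool" where
  "is_pgf f \<longleftrightarrow> (\<exists>N\<in>positive_rvs. \<forall>t\<in>{0..<1}. f t = pgf N t)"

definition closed_under_composition :: "nat pmf set \<Rightarrow> bool" where
  "closed_under_composition \<N> \<longleftrightarrow>
     (\<forall>N1\<in>\<N>. \<forall>N2\<in>\<N>. \<exists>N\<in>\<N>. \<forall>t\<in>{0..1}. pgf N t = pgf N1 (pgf N2 t))"


subsection \<open>Finite-dimensional models\<close>

text \<open>
  The dimension \<open>m\<close> is quantified inside the definition of a model, so \<open>\<real>\<^sup>m\<close> is the library space
  \<open>Euclidean_space m\<close> of sequences \<open>x :: nat \<Rightarrow> real\<close> with \<open>x j = 0\<close> for \<open>j \<ge> m\<close>. Its topology is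
  induced by the product topology on \<open>nat \<Rightarrow> real\<close>, so \<open>continuous_on\<close> and \<open>at x within S\<close> have their
  usual meaning on its subsets.

  \<open>C1_on m S f\<close>: \<open>f\<close> is Frechet differentiable relative to \<open>S\<close> at every point of \<open>S\<close>, with
  partial derivatives \<open>D j\<close> continuous on \<open>S\<close> (boundary points of \<open>S\<close> included).
\<close>

definition C1_on :: "nat \<Rightarrow> (nat \<Rightarrow> real) set \<Rightarrow> ((nat \<Rightarrow> real) \<Rightarrow> real) \<Rightarrow> bool" where
  "C1_on m S f \<longleftrightarrow>
     (\<exists>D :: nat \<Rightarrow> (nat \<Rightarrow> real) \<Rightarrow> real.
        (\<forall>j<m. continuous_on S (D j)) \<and>
        (\<forall>x\<in>S. ((\<lambda>y. (f y - f x - (\<Sum>j<m. D j x * (y j - x j)))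
                       / L2_set (\<lambda>j. y j - x j) {..<m}) \<longlongrightarrow> 0) (at x within S)))"

text \<open>
  An open set possibly with boundary is an open set together with a (possibly empty) part of its
  boundary.
\<close>

definition open_with_boundary :: "nat \<Rightarrow> (nat \<Rightarrow> real) set \<Rightarrow> bool" where
  "open_with_boundary m \<Theta> \<longleftrightarrow>
     (\<exists>U. openin (Euclidean_space m) U \<and> U \<subseteq> \<Theta> \<and> \<Theta> \<subseteq> Euclidean_space m closure_of U)"

definition half_space :: "nat \<Rightarrow> (nat \<Rightarrow> real) topology" where
  "half_space m = subtopology (Euclidean_space m) {x. 0 \<le> x 0}"

definition global_parametrization ::
  "nat \<Rightarrow> (nat \<Rightarrow> real) set \<Rightarrow> ((nat \<Rightarrow> real) \<Rightarrow> nat pmf) \<Rightarrow> nat pmf set \<Rightarrow> bool" where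
  "global_parametrization m \<Theta> P \<N> \<longleftrightarrow> open_with_boundary m \<Theta> \<and> bij_betw P \<Theta> \<N>"

text \<open>
  A model, as a set of probability sequences, is \<open>pmf ` \<N>\<close>. On probability sequences the product
  topology of \<open>nat \<Rightarrow> real\<close> coincides with the total variation (\<open>\<ell>\<^sup>1\<close>) topology (Scheffe).

  An atlas of an embedded manifold with boundary is a set of local parametrizations \<open>(W, P)\<close>: \<open>W\<close> is
  relatively open in the half-space, \<open>P\<close> is a homeomorphism from \<open>W\<close> onto a relatively open part of
  the model, and the changes of parameters are continuously differentiable. An open subset of
  \<open>\<real>\<^sup>m\<close> can be moved into the half-space, so interior charts are covered as well.
\<close>

definition manifold_atlas ::
  "nat \<Rightarrow> ((nat \<Rightarrow> real) set \<times> ((nat \<Rightarrow> real) \<Rightarrow> nat pmf)) set \<Rightarrow> nat pmf set \<Rightarrow> bool" where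
  "manifold_atlas m \<A> \<N> \<longleftrightarrow>
     \<N> = (\<Union>(W, P)\<in>\<A>. P ` W) \<and>
     (\<forall>(W, P)\<in>\<A>.
        openin (half_space m) W \<and>
        openin (top_of_set (pmf ` \<N>)) (pmf ` P ` W) \<and>
        (\<exists>g. homeomorphism W (pmf ` P ` W) (pmf \<circ> P) g)) \<and>
     (\<forall>(W, P)\<in>\<A>. \<forall>(W', P')\<in>\<A>. \<forall>j<m.
        C1_on m {x\<in>W. P x \<in> P' ` W'} (\<lambda>x. inv_into W' P' (P x) j))"

definition finite_dim_structure ::
  "nat \<Rightarrow> ((nat \<Rightarrow> real) set \<times> ((nat \<Rightarrow> real) \<Rightarrow> nat pmf)) set \<Rightarrow> nat pmf set \<Rightarrow> bool" where
  "finite_dim_structure m \<A> \<N> \<longleftrightarrow>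
     0 < m \<and>
     ((\<exists>\<Theta> P. \<A> = {(\<Theta>, P)} \<and> global_parametrization m \<Theta> P \<N>) \<or> manifold_atlas m \<A> \<N>)"

definition structure_interior ::
  "nat \<Rightarrow> ((nat \<Rightarrow> real) set \<times> ((nat \<Rightarrow> real) \<Rightarrow> nat pmf)) set \<Rightarrow> nat pmf set" where
  "structure_interior m \<A> = (\<Union>(W, P)\<in>\<A>. P ` (Euclidean_space m interior_of W))"

definition C1_probabilities ::
  "nat \<Rightarrow> ((nat \<Rightarrow> real) set \<times> ((nat \<Rightarrow> real) \<Rightarrow> nat pmf)) set \<Rightarrow> bool" where
  "C1_probabilities m \<A> \<longleftrightarrow> (\<forall>(W, P)\<in>\<A>. \<forall>i\<ge>1. C1_on m W (\<lambda>x. pmf (P x) i))"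

definition regular_stopping_model :: "nat pmf set \<Rightarrow> bool" where
  "regular_stopping_model \<N> \<longleftrightarrow>
     \<N> \<subseteq> positive_rvs \<and>
     closed_under_composition \<N> \<and>
     connected (pmf ` \<N>) \<and>
     (\<exists>m \<A>. finite_dim_structure m \<A> \<N> \<and> structure_interior m \<A> \<noteq> {} \<and> C1_probabilities m \<A>)"


subsection \<open>Koenigs function\<close>

text \<open>
  The Koenigs function of a model does not depend on the element \<open>N \<noteq> N_I\<close> used to compute it;
  the definition picks one.
\<close>

definition koenigs :: "nat pmf set \<Rightarrow> real \<Rightarrow> real" where
  "koenigs \<N> t =
     (let N = (SOME N. N \<in> \<N> \<and> N \<noteq> N_I)
      in lim (\<lambda>n. (pgf N ^^ n) t / (deriv (pgf N) 0) ^ n))"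

text \<open>
  The formula for \<open>\<phi>\<close> has a removable singularity at \<open>0\<close>; in HOL it would evaluate to \<open>1\<close> there, hence
  the limit.
\<close>

definition phi :: "nat pmf set \<Rightarrow> real \<Rightarrow> real" where
  "phi \<N> t =
     (let \<phi> = (\<lambda>s. 1 - koenigs \<N> s / (s * deriv (koenigs \<N>) s))
      in if t = 0 then Lim (at_right 0) \<phi> else \<phi> t)"

definition can_include_N_I :: "nat pmf set \<Rightarrow> bool" where
  "can_include_N_I \<N> \<longleftrightarrow>
     (\<forall>\<theta>\<in>{0<..1}. is_pgf (\<lambda>t. inv_into {0..<1} (koenigs \<N>) (\<theta> * koenigs \<N> t)))"

definition full_models :: "nat pmf set set" where
  "full_models =
     {\<N>. regular_stopping_model \<N> \<and> bij_betw (\<lambda>N. pmf N 1) \<N> {0<..1}}"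

definition phi_law :: "nat pmf set \<Rightarrow> nat pmf" where
  "phi_law \<N> = (THE q. q \<in> positive_rvs \<and> (\<forall>t\<in>{0..<1}. pgf q t = phi \<N> t))"

text \<open>
  The Harris--Dynkin criterion for the Markov branching process in which a particle is replaced by
  \<open>1 + J\<close> particles, \<open>J\<close> distributed as \<open>q\<close>. If the integral converges, \<open>K\<close> solving
  \<open>1 - K t / (t * K' t) = pgf q t\<close> stays bounded at \<open>1\<close>, and \<open>K\<^sup>-\<^sup>1 (\<theta> * K t)\<close> tends to a limit
  smaller than \<open>1\<close> as \<open>t\<close> tends to \<open>1\<close> when \<open>\<theta> < 1\<close>, so it is not the pgf of a (finite) random
  variable. This happens for instance for \<open>pgf q t = 1 - sqrt (1 - t)\<close>.
\<close>

definition nonexplosive :: "nat pmf \<Rightarrow> bool" where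
  "nonexplosive q \<longleftrightarrow> \<not> (\<lambda>t. 1 / (1 - pgf q t)) integrable_on {1/2..1}"

end

theory Submission
  imports Defs
begin

text \<open>
  In the coordinate given by the Koenigs function \<open>K\<close>, composition is multiplication by \<open>\<theta>\<close>: the
  candidates \<open>K\<^sup>-\<^sup>1 (\<theta> K t)\<close>, with \<open>\<theta> = exp (- u)\<close>, form the flow of \<open>y' = - K y / K' y = - y (1 - \<phi> y)\<close>.
  If all of them are pgfs, then \<open>\<phi> t\<close> is the limit as \<open>\<theta>\<close> tends to \<open>1\<close> of the pgfs
  \<open>(h\<^sub>\<theta> t - \<theta> t) / ((1 - \<theta>) t)\<close>, and no mass is lost because \<open>K\<close> is unbounded. Conversely, if \<open>\<phi>\<close> is a pgf,
  then the Euler scheme of the flow iterates the pgf \<open>t \<mapsto> (1 - e) t + e t \<phi> t\<close>, so its limits \<open>h\<^sub>\<theta>\<close> are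
  pgfs. The manifold structure of a model enters only through the existence of an element other than
  \<open>N_I\<close>; in a model with parameter space \<open>(0,1]\<close> the parameter is multiplicative and injective, so the
  elements commute and share their Koenigs function. For a nonexplosive law, \<open>K\<close> is recovered by
  solving \<open>t K' t (1 - \<phi> t) = K t\<close>.
\<close>

subsection \<open>Probability generating functions\<close>

text \<open>Not every law arises as \<open>phi_law\<close> of a full model: \<open>K\<close> has to
  be unbounded, and as \<open>(ln K)' = 1 / (t * (1 - \<phi>))\<close>, this says that the integral
  of \<open>1 / (1 - \<phi>)\<close> diverges at 1. So \<open>phi_law\<close> itself is matched with
  the nonexplosive laws, and the correspondence with all positive laws rests on Schroeder-Bernstein,
  where exponential tilting supplies the injection into the nonexplosive laws. The error of the
  Euler scheme is measured in \<open>ln K\<close>, which the exact flow lowers at unit rate: a step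
  of length \<open>e\<close> lowers it by \<open>e\<close> up to relative errors of order
  \<open>e\<close>, and these vanish when the total time is fixed. A limit of pgfs is obtained by
  selecting a subsequence whose coefficients converge; that its total mass is 1 is then read off its
  values near 1. To see that the laws of a semigroup form a regular model, their probabilities are
  shown to be polynomials in \<theta>. This settles connectedness and differentiability at once, the
  boundary point \<theta> = 1 included.\<close>

lemma summable_pmf_nat: "summable (pmf (N::nat pmf))"
  using sums_integral_count_space_nat[OF integrable_pmf] by (simp add: sums_iff)

lemma suminf_pmf_nat: "(\<Sum>i. pmf (N::nat pmf) i) = 1"
proof -
  have "(\<Sum>i. pmf N i) = (LINT i|count_space UNIV. pmf N i)"
    using integrable_pmf by (rule integral_count_space_nat[symmetric])
  also have "\<dots> = 1"
    by (simp add: integral_pmf)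
  finally show ?thesis .
qed

lemma summable_pgf:
  assumes "\<bar>t\<bar> \<le> 1"
  shows "summable (\<lambda>i. pmf N i * t ^ i)"
proof (rule summable_comparison_test'[OF summable_pmf_nat[of N]])
  fix i
  have "\<bar>t\<bar> ^ i \<le> 1" using assms by (simp add: power_le_one)
  then show "norm (pmf N i * t ^ i) \<le> pmf N i"
    by (simp add: abs_mult power_abs mult_left_le)
qed

lemma pgf_sums: "\<bar>t\<bar> \<le> 1 \<Longrightarrow> (\<lambda>i. pmf N i * t ^ i) sums pgf N t"
  unfolding pgf_def by (rule summable_sums[OF summable_pgf])

lemma pgf_1 [simp]: "pgf N 1 = 1"
  by (simp add: pgf_def suminf_pmf_nat)

lemma pgf_0 [simp]: "pgf N 0 = pmf N 0"
  unfolding pgf_def by (rule sums_unique[symmetric]) (use powser_sums_zero in blast)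

lemma pgf_mono: "0 \<le> s \<Longrightarrow> s \<le> t \<Longrightarrow> t \<le> 1 \<Longrightarrow> pgf N s \<le> pgf N t"
  unfolding pgf_def by (intro suminf_le summable_pgf mult_left_mono power_mono) auto

lemma pgf_nonneg: "0 \<le> t \<Longrightarrow> t \<le> 1 \<Longrightarrow> 0 \<le> pgf N t"
  unfolding pgf_def by (intro suminf_nonneg summable_pgf) auto

lemma pgf_le_1: "0 \<le> t \<Longrightarrow> t \<le> 1 \<Longrightarrow> pgf N t \<le> 1"
  using pgf_mono[of t 1 N] by simp

text \<open>As an expectation, the pgf of a mixture \<open>bind_pmf\<close> becomes an iterated
  integral; the pgf of a composition is computed in this form.\<close>

lemma pgf_eq_expectation:
  assumes "\<bar>t\<bar> \<le> 1"
  shows "pgf N t = measure_pmf.expectation N (\<lambda>n. t ^ n)"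
proof -
  have "summable (\<lambda>i. pmf N i * \<bar>t\<bar> ^ i)"
    using assms by (intro summable_pgf) auto
  then have "integrable (count_space UNIV) (\<lambda>i. pmf N i * t ^ i)"
    by (simp add: integrable_count_space_nat_iff abs_mult power_abs)
  then have "(LINT i|count_space UNIV. pmf N i * t ^ i) = pgf N t"
    unfolding pgf_def by (rule integral_count_space_nat)
  then show ?thesis
    by (simp add: measure_pmf_eq_density integral_density)
qed

lemma pmf_mult_power_le_pgf: "0 \<le> t \<Longrightarrow> t \<le> 1 \<Longrightarrow> pmf N i * t ^ i \<le> pgf N t"
  using sum_le_suminf[OF summable_pgf[of t N], of "{i}"] by (auto simp: pgf_def)

lemma pgf_pos:
  assumes "0 < t" "t \<le> 1"
  shows "0 < pgf N t"
proof -
  obtain i where "i \<in> set_pmf N" using set_pmf_not_empty by fast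
  then have "0 < pmf N i * t ^ i" using assms by (simp add: pmf_positive)
  also have "\<dots> \<le> pgf N t" using assms by (intro pmf_mult_power_le_pgf) auto
  finally show ?thesis .
qed

text \<open>Without mass at 0 only the powers \<open>t ^ i\<close> with \<open>i \<ge> 1\<close>
  occur, and these are at most \<open>t\<close>.\<close>

lemma pgf_le_arg:
  assumes "N \<in> positive_rvs" "0 \<le> t" "t \<le> 1"
  shows "pgf N t \<le> t"
proof -
  have "pgf N t \<le> (\<Sum>i. pmf N i * t)"
    unfolding pgf_def
  proof (intro suminf_le summable_pgf summable_mult2 summable_pmf_nat)
    fix i show "pmf N i * t ^ i \<le> pmf N i * t"
    proof (cases i)
      case 0 then show ?thesis using assms by (simp add: positive_rvs_def)
    next
      case (Suc j)
      then show ?thesis using assms by (intro mult_left_mono) (auto simp: mult_left_le power_le_one)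
    qed
  qed (use assms in auto)
  also have "\<dots> = t"
    by (simp add: suminf_mult2[symmetric] suminf_pmf_nat summable_pmf_nat)
  finally show ?thesis .
qed

lemma pgf_in_unit: "N \<in> positive_rvs \<Longrightarrow> t \<in> {0..<1} \<Longrightarrow> pgf N t \<in> {0..<1}"
  using pgf_le_arg[of N t] pgf_nonneg[of t N] by auto

lemma continuous_on_pgf: "continuous_on {0..1} (pgf N)"
proof -
  have "uniform_limit {0..1} (\<lambda>n t. \<Sum>i<n. pmf N i * t ^ i) (\<lambda>t. \<Sum>i. pmf N i * t ^ i) sequentially"
  proof (rule Weierstrass_m_test[OF _ summable_pmf_nat[of N]])
    fix i and t :: real assume "t \<in> {0..1}"
    then show "norm (pmf N i * t ^ i) \<le> pmf N i"
      by (simp add: abs_mult power_abs mult_left_le power_le_one)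
  qed
  then have "continuous_on {0..1} (\<lambda>t. \<Sum>i. pmf N i * t ^ i)"
    by (rule uniform_limit_theorem[rotated]) (auto intro!: continuous_intros always_eventually)
  then show ?thesis by (simp add: pgf_def[abs_def])
qed

lemma pgf_has_derivative_at_0: "(pgf N has_real_derivative pmf N 1) (at 0)"
proof -
  have "((\<lambda>z. \<Sum>n. pmf N n * z ^ n) has_field_derivative (\<Sum>n. diffs (pmf N) n * 0 ^ n)) (at 0)"
    by (rule termdiffs_strong'[where K=1]) (auto intro: summable_pgf)
  moreover have "(\<Sum>n. diffs (pmf N) n * 0 ^ n) = pmf N 1"
    by (simp add: sums_unique[OF powser_sums_zero, symmetric] diffs_def)
  ultimately show ?thesis by (simp add: pgf_def[abs_def])
qed

lemma deriv_pgf_0: "deriv (pgf N) 0 = pmf N 1"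
  by (rule DERIV_imp_deriv[OF pgf_has_derivative_at_0])

lemma pgf_ratio_tendsto:
  assumes "N \<in> positive_rvs"
  shows "((\<lambda>t. pgf N t / t) \<longlongrightarrow> pmf N 1) (at_right 0)"
proof -
  have "((\<lambda>t. (pgf N t - pgf N 0) / (t - 0)) \<longlongrightarrow> pmf N 1) (at 0)"
    using pgf_has_derivative_at_0[of N] by (simp add: has_field_derivative_iff)
  then show ?thesis using assms
    by (simp add: positive_rvs_def filterlim_at_split)
qed

section \<open>Uniqueness of coefficients from values on the open unit interval\<close>

lemma powser_zero_imp_head_zero:
  fixes d :: "nat \<Rightarrow> real"
  assumes "\<And>t. \<bar>t\<bar> < 1 \<Longrightarrow> summable (\<lambda>i. d i * t ^ i)"
    and "\<And>t. 0 < t \<Longrightarrow> t < 1 \<Longrightarrow> (\<Sum>i. d i * t ^ i) = 0"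
  shows "d 0 = 0"
proof -
  have "((\<lambda>t. \<Sum>i. d i * t ^ i) \<longlongrightarrow> d 0) (at 0)"
    by (rule powser_limit_0[of 1]) (auto intro!: summable_sums assms(1))
  then have "((\<lambda>t. \<Sum>i. d i * t ^ i) \<longlongrightarrow> d 0) (at_right 0)"
    by (simp add: filterlim_at_split)
  moreover have "((\<lambda>t. \<Sum>i. d i * t ^ i) \<longlongrightarrow> 0) (at_right 0)"
  proof (rule tendsto_eventually)
    show "\<forall>\<^sub>F t in at_right 0. (\<Sum>i. d i * t ^ i) = 0"
      using assms(2) by (auto simp: eventually_at_right_field intro!: exI[of _ 1])
  qed
  ultimately show ?thesis using tendsto_unique trivial_limit_at_right_real by blast
qed

text \<open>The sum is continuous at 0, so its limit from the right already gives the constant term;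
  once that vanishes, dividing by \<open>t\<close> shifts the coefficients and the induction
  continues.\<close>

lemma powser_zero_imp_coeff_zero:
  fixes d :: "nat \<Rightarrow> real"
  assumes "\<And>t. \<bar>t\<bar> < 1 \<Longrightarrow> summable (\<lambda>i. d i * t ^ i)"
    and "\<And>t. 0 < t \<Longrightarrow> t < 1 \<Longrightarrow> (\<Sum>i. d i * t ^ i) = 0"
  shows "d n = 0"
  using assms
proof (induction n arbitrary: d)
  case 0
  then show ?case by (rule powser_zero_imp_head_zero)
next
  case (Suc n)
  have d0: "d 0 = 0" using Suc.prems by (rule powser_zero_imp_head_zero)
  show ?case
  proof (rule Suc.IH)
    fix t :: real assume t: "\<bar>t\<bar> < 1"
    show "summable (\<lambda>i. d (Suc i) * t ^ i)"
      using powser_split_head(3)[OF Suc.prems(1)[OF t]] .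
  next
    fix t :: real assume t: "0 < t" "t < 1"
    then show "(\<Sum>i. d (Suc i) * t ^ i) = 0"
      using powser_split_head(1)[of d t] Suc.prems d0 by auto
  qed
qed

text \<open>The word \<open>nonneg\<close> refers to the arguments \<open>t\<close>, not to the
  coefficients. Convergence at negative \<open>t\<close> follows from convergence at some
  \<open>s\<close> with \<open>\<bar>t\<bar> < s < 1\<close>.\<close>

lemma nonneg_powser_cong:
  fixes a b :: "nat \<Rightarrow> real"
  assumes "\<And>t. 0 \<le> t \<Longrightarrow> t < 1 \<Longrightarrow> summable (\<lambda>i. a i * t ^ i)"
    and "\<And>t. 0 \<le> t \<Longrightarrow> t < 1 \<Longrightarrow> summable (\<lambda>i. b i * t ^ i)"
    and "\<And>t. 0 < t \<Longrightarrow> t < 1 \<Longrightarrow> (\<Sum>i. a i * t ^ i) = (\<Sum>i. b i * t ^ i)"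
  shows "a = b"
proof
  have *: "summable (\<lambda>i. c i * t ^ i)"
    if c: "\<And>t. 0 \<le> t \<Longrightarrow> t < 1 \<Longrightarrow> summable (\<lambda>i. c i * t ^ i)" and t: "\<bar>t\<bar> < 1"
    for c :: "nat \<Rightarrow> real" and t
  proof -
    from t obtain s where "\<bar>t\<bar> < s" "s < 1" using dense by blast
    then show ?thesis by (intro powser_inside[OF c[of s]]) auto
  qed
  fix n
  have "a n - b n = 0"
  proof (rule powser_zero_imp_coeff_zero[where d="\<lambda>i. a i - b i"])
    fix t :: real assume "\<bar>t\<bar> < 1"
    then show "summable (\<lambda>i. (a i - b i) * t ^ i)"
      using summable_diff[OF *[OF assms(1)] *[OF assms(2)]] by (simp add: left_diff_distrib)
  next
    fix t :: real assume "0 < t" "t < 1"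
    then show "(\<Sum>i. (a i - b i) * t ^ i) = 0"
      using suminf_diff[OF assms(1)[of t] assms(2)[of t]] assms(3)[of t] by (simp add: left_diff_distrib)
  qed
  then show "a n = b n" by simp
qed

lemma pgf_inject:
  assumes "\<And>t. 0 < t \<Longrightarrow> t < 1 \<Longrightarrow> pgf M t = pgf N t"
  shows "M = N"
proof -
  have "pmf M = pmf N"
    using assms by (intro nonneg_powser_cong summable_pgf) (auto simp: pgf_def)
  then show ?thesis by (simp add: pmf_eq_iff)
qed

lemma positive_rvsI: "pgf N 0 = 0 \<Longrightarrow> N \<in> positive_rvs"
  by (simp add: positive_rvs_def)

lemma eq_N_I: "pmf N 1 = 1 \<Longrightarrow> N = N_I"
  unfolding N_I_def
  by (metis measure_pmf.prob_eq_1 measure_pmf_single AE_measure_pmf_iff set_pmf_subset_singleton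
      singletonD sets_measure_pmf UNIV_I subsetI)

lemma pgf_N_I [simp]: "pgf N_I t = t"
proof -
  have "pgf N_I t = (\<Sum>i. if i = 1 then t else 0)"
    unfolding pgf_def N_I_def by (intro suminf_cong) (auto simp: indicator_def)
  then show ?thesis by (simp add: sums_unique[OF sums_single, symmetric])
qed

lemma N_I_positive: "N_I \<in> positive_rvs"
  by (simp add: positive_rvs_def N_I_def)

section \<open>Composition of laws as random sums\<close>

primrec iid_sum_pmf :: "nat pmf \<Rightarrow> nat \<Rightarrow> nat pmf" where
  "iid_sum_pmf M 0 = return_pmf 0"
| "iid_sum_pmf M (Suc n) = bind_pmf M (\<lambda>x. map_pmf (\<lambda>y. x + y) (iid_sum_pmf M n))"

text \<open>A sum of \<open>N\<close> independent copies of \<open>M\<close>: this realizes the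
  composed pgf by an actual law, independently of any model.\<close>

definition comp_pmf :: "nat pmf \<Rightarrow> nat pmf \<Rightarrow> nat pmf" where
  "comp_pmf N M = bind_pmf N (iid_sum_pmf M)"

lemma pgf_bind_pmf:
  assumes "\<bar>t\<bar> \<le> 1"
  shows "pgf (bind_pmf N f) t = measure_pmf.expectation N (\<lambda>n. pgf (f n) t)"
proof -
  have "pgf (bind_pmf N f) t = measure_pmf.expectation (bind_pmf N f) (\<lambda>n. t ^ n)"
    using assms by (rule pgf_eq_expectation)
  also have "\<dots> = measure_pmf.expectation N (\<lambda>n. measure_pmf.expectation (f n) (\<lambda>n. t ^ n))"
    unfolding measure_pmf_bind
    by (rule integral_bind[where K="count_space UNIV" and B=1 and B'=1])
      (use assms in \<open>auto simp: power_abs power_le_one measure_pmf.emeasure_space_1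
        space_subprob_algebra measure_pmf.subprob_space_axioms\<close>)
  finally show ?thesis using assms by (simp add: pgf_eq_expectation)
qed

lemma pgf_iid_sum_pmf: "\<bar>t\<bar> \<le> 1 \<Longrightarrow> pgf (iid_sum_pmf M n) t = pgf M t ^ n"
proof (induction n)
  case 0 then show ?case by (simp add: pgf_eq_expectation)
next
  case (Suc n)
  have "pgf (map_pmf (\<lambda>y. x + y) (iid_sum_pmf M n)) t = t ^ x * pgf M t ^ n" for x
    using Suc by (simp add: pgf_eq_expectation power_add)
  then show ?case
    using Suc.prems by (simp add: pgf_bind_pmf) (simp add: pgf_eq_expectation)
qed

lemma abs_pgf_le_1: "\<bar>t\<bar> \<le> 1 \<Longrightarrow> \<bar>pgf N t\<bar> \<le> 1"
proof -
  assume t: "\<bar>t\<bar> \<le> 1"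
  have "\<bar>pgf N t\<bar> \<le> (\<Sum>i. \<bar>pmf N i * t ^ i\<bar>)"
    unfolding pgf_def using summable_pgf[of "\<bar>t\<bar>" N] t
    by (intro summable_rabs) (simp add: abs_mult power_abs)
  also have "\<dots> = pgf N \<bar>t\<bar>" by (simp add: pgf_def abs_mult power_abs)
  also have "\<dots> \<le> 1" using t by (intro pgf_le_1) auto
  finally show ?thesis .
qed

lemma pgf_comp_pmf: "\<bar>t\<bar> \<le> 1 \<Longrightarrow> pgf (comp_pmf N M) t = pgf N (pgf M t)"
  unfolding comp_pmf_def
  by (simp add: pgf_bind_pmf pgf_iid_sum_pmf) (simp add: pgf_eq_expectation[symmetric] abs_pgf_le_1)

lemma comp_pmf_positive: "N \<in> positive_rvs \<Longrightarrow> M \<in> positive_rvs \<Longrightarrow> comp_pmf N M \<in> positive_rvs"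
  by (rule positive_rvsI) (simp add: pgf_comp_pmf positive_rvs_def del: pgf_0, simp)

text \<open>One Euler step of length \<open>e\<close> for \<open>y' = - y * (1 - pgf q y)\<close>:
  with probability \<open>e\<close> a particle is replaced by \<open>1 + J\<close> particles with
  \<open>J\<close> distributed as \<open>q\<close>, otherwise it stays alone.\<close>

definition euler_pmf :: "real \<Rightarrow> nat pmf \<Rightarrow> nat pmf" where
  "euler_pmf e q = bind_pmf (bernoulli_pmf e) (\<lambda>b. if b then map_pmf Suc q else N_I)"

lemma pgf_euler_pmf:
  assumes "0 \<le> e" "e \<le> 1" "\<bar>t\<bar> \<le> 1"
  shows "pgf (euler_pmf e q) t = (1 - e) * t + e * t * pgf q t"
proof -
  have "pgf (map_pmf Suc q) t = t * pgf q t"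
    using assms by (simp add: pgf_eq_expectation)
  then show ?thesis
    using assms by (simp add: euler_pmf_def pgf_bind_pmf)
qed

primrec iterate_pmf :: "nat pmf \<Rightarrow> nat \<Rightarrow> nat pmf" where
  "iterate_pmf N 0 = N_I"
| "iterate_pmf N (Suc n) = comp_pmf N (iterate_pmf N n)"

lemma pgf_iterate_pmf: "\<bar>t\<bar> \<le> 1 \<Longrightarrow> pgf (iterate_pmf N n) t = (pgf N ^^ n) t"
  by (induction n) (auto simp: pgf_comp_pmf)

lemma iterate_pmf_positive: "N \<in> positive_rvs \<Longrightarrow> iterate_pmf N n \<in> positive_rvs"
  by (induction n) (auto simp: N_I_positive comp_pmf_positive)

section \<open>Limits of nonnegative power series\<close>

text \<open>The bound at a point \<open>s\<close> strictly between \<open>t\<close> and 1 turns into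
  the geometric majorant \<open>B s * (t / s) ^ i\<close> at \<open>t\<close>, uniformly in
  \<open>n\<close>, so Tannery's theorem applies.\<close>

lemma dominated_powser_tendsto:
  fixes a :: "nat \<Rightarrow> nat \<Rightarrow> real"
  assumes nonneg: "\<And>n i. 0 \<le> a n i"
    and sm: "\<And>n t. 0 \<le> t \<Longrightarrow> t < 1 \<Longrightarrow> summable (\<lambda>i. a n i * t ^ i)"
    and bnd: "\<And>n t. 0 \<le> t \<Longrightarrow> t < 1 \<Longrightarrow> (\<Sum>i. a n i * t ^ i) \<le> B t"
    and lim: "\<And>i. (\<lambda>n. a n i) \<longlonglongrightarrow> c i"
    and t: "0 \<le> t" "t < 1"
  shows "summable (\<lambda>i. c i * t ^ i)" "(\<lambda>n. \<Sum>i. a n i * t ^ i) \<longlonglongrightarrow> (\<Sum>i. c i * t ^ i)"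
proof -
  obtain s where s: "t < s" "s < 1" using t dense by blast
  have le: "a n i * s ^ i \<le> B s" for n i
    using sum_le_suminf[OF sm[of s n], of "{i}"] bnd[of s n] nonneg s t by force
  have "a n i * t ^ i \<le> B s * (t / s) ^ i" for n i
  proof -
    have "a n i * t ^ i = a n i * s ^ i * (t / s) ^ i"
      using s t by (simp add: power_divide)
    also have "\<dots> \<le> B s * (t / s) ^ i"
      using s t by (intro mult_right_mono le) auto
    finally show ?thesis .
  qed
  then have bound: "norm (a n i * t ^ i) \<le> B s * (t / s) ^ i" for n i
    using nonneg t by simp
  have geo: "summable (\<lambda>i. B s * (t / s) ^ i)"
    using s t by (intro summable_mult summable_geometric) auto
  have cl: "(\<lambda>n. a n i * t ^ i) \<longlonglongrightarrow> c i * t ^ i" for i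
    by (intro tendsto_intros lim)
  have "norm (c i * t ^ i) \<le> B s * (t / s) ^ i" for i
    using bound by (intro tendsto_upperbound[OF tendsto_norm[OF cl]]) auto
  then show "summable (\<lambda>i. c i * t ^ i)"
    by (intro summable_comparison_test'[OF geo])
  then show "(\<lambda>n. \<Sum>i. a n i * t ^ i) \<longlonglongrightarrow> (\<Sum>i. c i * t ^ i)"
    using tannerys_theorem[where a="\<lambda>i n. a n i * t ^ i", OF cl _ geo trivial_limit_sequentially]
    using bound by (simp add: always_eventually case_prod_unfold)
qed

text \<open>A selection principle: the bound on the sums at 1/2 confines coefficient
  \<open>i\<close> to a fixed compact interval, so by compactness of the product some subsequence
  converges coefficientwise. The preceding lemma carries this over to the sums, whose limit
  \<open>f\<close> is already known.\<close>

lemma nonneg_powser_limit: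
  fixes a :: "nat \<Rightarrow> nat \<Rightarrow> real"
  assumes nonneg: "\<And>n i. 0 \<le> a n i"
    and sm: "\<And>n t. 0 \<le> t \<Longrightarrow> t < 1 \<Longrightarrow> summable (\<lambda>i. a n i * t ^ i)"
    and lim: "\<And>t. 0 \<le> t \<Longrightarrow> t < 1 \<Longrightarrow> (\<lambda>n. \<Sum>i. a n i * t ^ i) \<longlonglongrightarrow> f t"
  shows "\<exists>c r. strict_mono (r :: nat \<Rightarrow> nat) \<and> (\<forall>i. 0 \<le> c i \<and> (\<lambda>n. a (r n) i) \<longlonglongrightarrow> c i) \<and>
    (\<forall>t. 0 \<le> t \<and> t < 1 \<longrightarrow> summable (\<lambda>i. c i * t ^ i) \<and> f t = (\<Sum>i. c i * t ^ i))"
proof -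
  have "\<exists>B. \<forall>n. (\<Sum>i. a n i * t ^ i) \<le> B" if "0 \<le> t" "t < 1" for t
    using convergent_imp_Bseq[OF convergentI[OF lim[OF that]]]
    by (auto simp: Bseq_def) (meson abs_le_D1)
  then obtain B where B: "\<And>n t. 0 \<le> t \<Longrightarrow> t < 1 \<Longrightarrow> (\<Sum>i. a n i * t ^ i) \<le> B t"
    by metis
  define S where "S i = {0 .. B (1/2) * 2 ^ i}" for i :: nat
  have "compact (PiE UNIV S)"
    using compactin_PiE[of "\<lambda>_. euclidean" UNIV S]
    by (simp add: euclidean_product_topology compactin_euclidean_iff S_def)
  then have "seq_compact (PiE UNIV S)" by (rule compact_imp_seq_compact)
  moreover have "a n \<in> PiE UNIV S" for n
  proof -
    have "a n i * (1/2) ^ i \<le> B (1/2)" for i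
      using sum_le_suminf[OF sm[of "1/2" n], of "{i}"] B[of "1/2" n] nonneg by force
    then show ?thesis using nonneg by (auto simp: S_def field_simps)
  qed
  ultimately obtain c r where r: "strict_mono (r :: nat \<Rightarrow> nat)" "(a \<circ> r) \<longlonglongrightarrow> c"
    unfolding seq_compact_def by blast
  have cl: "(\<lambda>n. a (r n) i) \<longlonglongrightarrow> c i" for i
    using continuous_on_tendsto_compose[OF continuous_on_product_coordinates r(2)]
    by (simp add: o_def)
  have dom: "summable (\<lambda>i. c i * t ^ i)" "(\<lambda>n. \<Sum>i. a (r n) i * t ^ i) \<longlonglongrightarrow> (\<Sum>i. c i * t ^ i)"
    if "0 \<le> t" "t < 1" for t
    by (rule dominated_powser_tendsto[where B=B]; fact nonneg sm B cl that)+
  have "0 \<le> c i" for i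
    using nonneg by (intro tendsto_lowerbound[OF cl]) auto
  moreover have "f t = (\<Sum>i. c i * t ^ i)" if t: "0 \<le> t" "t < 1" for t
  proof -
    have "(\<lambda>n. \<Sum>i. a (r n) i * t ^ i) \<longlonglongrightarrow> f t"
      using LIMSEQ_subseq_LIMSEQ[OF lim[OF t] r(1)] by (simp add: o_def)
    then show "f t = (\<Sum>i. c i * t ^ i)"
      using dom(2)[OF t] LIMSEQ_unique by blast
  qed
  ultimately show ?thesis
    using r(1) cl dom(1) by (intro exI[of _ c] exI[of _ r]) auto
qed

lemma pmf_of_coefficients:
  fixes c :: "nat \<Rightarrow> real"
  assumes "\<And>i. 0 \<le> c i" "c sums 1"
  obtains N where "pmf N = c"
proof -
  have "(\<integral>\<^sup>+i. ennreal (c i) \<partial>count_space UNIV) = 1"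
    using assms by (simp add: nn_integral_count_space_nat suminf_ennreal_eq sums_unique[symmetric])
  then have "pmf (embed_pmf c) = c"
    using assms by (intro ext pmf_embed_pmf) auto
  then show ?thesis by (rule that)
qed

text \<open>The two last hypotheses fix the total mass: \<open>le\<close> gives at most 1 by letting
  \<open>t\<close> tend to 1 in partial sums, and \<open>ge\<close> excludes a loss of mass to
  infinity, since every value of \<open>f\<close> is a lower bound for the total.\<close>

lemma is_pgf_of_coefficients:
  fixes c :: "nat \<Rightarrow> real"
  assumes c: "\<And>i. 0 \<le> c i" "c 0 = 0"
    and sm: "\<And>t. 0 \<le> t \<Longrightarrow> t < 1 \<Longrightarrow> summable (\<lambda>i. c i * t ^ i)"
    and f: "\<And>t. 0 \<le> t \<Longrightarrow> t < 1 \<Longrightarrow> f t = (\<Sum>i. c i * t ^ i)"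
    and le: "\<And>t. 0 \<le> t \<Longrightarrow> t < 1 \<Longrightarrow> f t \<le> 1"
    and ge: "\<And>s. s < 1 \<Longrightarrow> \<exists>t\<in>{0..<1}. s \<le> f t"
  shows "is_pgf f"
proof -
  have part: "(\<Sum>i<n. c i) \<le> 1" for n
  proof -
    have "((\<lambda>t. \<Sum>i<n. c i * t ^ i) \<longlongrightarrow> (\<Sum>i<n. c i * 1 ^ i)) (at_left 1)"
      by (intro tendsto_intros)
    moreover have "\<forall>\<^sub>F t in at_left (1::real). (\<Sum>i<n. c i * t ^ i) \<le> 1"
      unfolding eventually_at_left_field
    proof (intro exI[of _ 0] conjI allI impI)
      fix t :: real assume t: "0 < t" "t < 1"
      have "(\<Sum>i<n. c i * t ^ i) \<le> (\<Sum>i. c i * t ^ i)"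
        using t c by (intro sum_le_suminf sm) auto
      with f[of t] le[of t] t show "(\<Sum>i<n. c i * t ^ i) \<le> 1" by simp
    qed simp
    ultimately show ?thesis
      by (intro tendsto_upperbound[of "\<lambda>t. \<Sum>i<n. c i * t ^ i" "\<Sum>i<n. c i" "at_left 1" 1]) auto
  qed
  then have smc: "summable c"
    using c by (intro summableI_nonneg_bounded[where x=1]) auto
  have "suminf c \<le> 1"
    using part by (intro suminf_le_const smc) auto
  moreover have "1 \<le> suminf c"
  proof (rule dense_le)
    fix s :: real assume "s < 1"
    then obtain t where t: "0 \<le> t" "t < 1" "s \<le> f t" using ge by force
    have "f t \<le> suminf c"
      unfolding f[OF t(1,2)] using t c
      by (intro suminf_le sm smc mult_left_le) (auto simp: power_le_one)
    then show "s \<le> suminf c" using t by simp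
  qed
  ultimately have "c sums 1" using smc by (simp add: sums_iff)
  then obtain N where "pmf N = c" using pmf_of_coefficients c by metis
  then show ?thesis
    unfolding is_pgf_def positive_rvs_def pgf_def using f c by (intro bexI[of _ N]) auto
qed

subsection \<open>Linearized semigroups\<close>

text \<open>Convexity with the denominators cleared: \<open>(1 - pgf N t) / (1 - t)\<close> is an
  average of the geometric sums \<open>\<Sum>k<i. t ^ k\<close>, and these increase with
  \<open>t\<close>.\<close>

lemma pgf_secant_slope_mono:
  assumes "0 \<le> s" "s \<le> t" "t < 1"
  shows "(1 - pgf N s) * (1 - t) \<le> (1 - pgf N t) * (1 - s)"
proof -
  have one: "1 - pgf N r = (\<Sum>i. pmf N i * (1 - r ^ i))" "summable (\<lambda>i. pmf N i * (1 - r ^ i))"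
    if "0 \<le> r" "r < 1" for r
    using suminf_diff[OF summable_pmf_nat[of N] summable_pgf[of r N]]
      summable_diff[OF summable_pmf_nat[of N] summable_pgf[of r N]] that
    by (auto simp: suminf_pmf_nat pgf_def right_diff_distrib)
  have pw: "(1 - s ^ i) * (1 - t) \<le> (1 - t ^ i) * (1 - s)" for i
  proof -
    have "(\<Sum>k<i. s ^ k) \<le> (\<Sum>k<i. t ^ k)"
      using assms by (intro sum_mono power_mono) auto
    then have "(1 - s) * (1 - t) * (\<Sum>k<i. s ^ k) \<le> (1 - s) * (1 - t) * (\<Sum>k<i. t ^ k)"
      using assms by (intro mult_left_mono) auto
    then show ?thesis
      by (simp add: one_diff_power_eq mult_ac)
  qed
  have "(1 - pgf N s) * (1 - t) = (\<Sum>i. pmf N i * (1 - s ^ i) * (1 - t))"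
    using one[of s] assms by (simp add: suminf_mult2)
  also have "\<dots> \<le> (\<Sum>i. pmf N i * (1 - t ^ i) * (1 - s))"
    using one[of s] one[of t] assms pw
    by (intro suminf_le summable_mult2) (auto simp: mult.assoc intro!: mult_left_mono)
  also have "\<dots> = (1 - pgf N t) * (1 - s)"
    using one[of t] assms by (simp add: suminf_mult2)
  finally show ?thesis .
qed

text \<open>Common interface of the two sources of such functions: Koenigs limits of pgfs, and
  solutions of the generator equation for a given law. Unboundedness makes \<open>K\<close> a
  bijection from \<open>{0..<1}\<close> onto the nonnegative reals, so that every value
  \<open>\<theta> * K t\<close> with \<open>0 \<le> \<theta>\<close> has a preimage.\<close>

locale linearizer =
  fixes K :: "real \<Rightarrow> real"
  assumes K_0: "K 0 = 0"
    and K_ratio: "((\<lambda>t. K t / t) \<longlongrightarrow> 1) (at_right 0)"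
    and K_differentiable: "0 < t \<Longrightarrow> t < 1 \<Longrightarrow> K differentiable (at t)"
    and K_deriv_pos: "0 < t \<Longrightarrow> t < 1 \<Longrightarrow> 0 < deriv K t"
    and K_unbounded: "\<exists>t\<in>{0..<1}. B < K t"
begin

definition flow :: "real \<Rightarrow> real \<Rightarrow> real" where
  "flow \<theta> t = inv_into {0..<1} K (\<theta> * K t)"

lemma K_has_derivative: "0 < t \<Longrightarrow> t < 1 \<Longrightarrow> (K has_real_derivative deriv K t) (at t)"
  using K_differentiable DERIV_deriv_iff_real_differentiable by blast

lemma K_continuous: "continuous_on {0..<1} K"
  unfolding continuous_on_eq_continuous_within
proof
  fix t :: real assume t: "t \<in> {0..<1}"
  show "continuous (at t within {0..<1}) K"
  proof (cases "t = 0")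
    case True
    \<comment> \<open>Differentiability is available only inside the interval; at 0 the
      normalization of \<open>K t / t\<close> takes its place.\<close>
    have "((\<lambda>t. K t / t * t) \<longlongrightarrow> 1 * 0) (at_right 0)"
      by (intro tendsto_mult K_ratio tendsto_ident_at)
    moreover have "\<forall>\<^sub>F t in at_right 0. K t / t * t = K t"
      by (auto simp: eventually_at_right_field intro!: exI[of _ 1])
    ultimately have "(K \<longlongrightarrow> 0) (at_right 0)"
      by (auto elim: Lim_transform_eventually)
    moreover have "at 0 within {0..<1} \<le> at_right (0::real)"
      unfolding at_within_def by (intro inf_mono) auto
    ultimately have "(K \<longlongrightarrow> 0) (at 0 within {0..<1})"
      using tendsto_mono by blast
    then show ?thesis
      using True K_0 by (simp add: continuous_within)
  next
    case False
    then show ?thesis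
      using t K_has_derivative[of t] DERIV_isCont continuous_at_imp_continuous_at_within by force
  qed
qed

lemma K_strict_mono:
  assumes st: "0 \<le> s" "s < t" "t < 1"
  shows "K s < K t"
  using st(2)
proof (rule DERIV_pos_imp_increasing_open)
  show "\<exists>y. (K has_real_derivative y) (at x) \<and> 0 < y" if "s < x" "x < t" for x
    using K_has_derivative[of x] K_deriv_pos[of x] that st by auto
  show "continuous_on {s..t} K"
    using st by (intro continuous_on_subset[OF K_continuous]) auto
qed

lemma K_mono: "0 \<le> s \<Longrightarrow> s \<le> t \<Longrightarrow> t < 1 \<Longrightarrow> K s \<le> K t"
  using K_strict_mono[of s t] by (cases "s = t") auto

lemma K_pos: "0 < t \<Longrightarrow> t < 1 \<Longrightarrow> 0 < K t"
  using K_strict_mono[of 0 t] K_0 by simp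

lemma K_nonneg: "0 \<le> t \<Longrightarrow> t < 1 \<Longrightarrow> 0 \<le> K t"
  using K_mono[of 0 t] K_0 by simp

lemma ln_K_has_derivative:
  "0 < t \<Longrightarrow> t < 1 \<Longrightarrow> ((\<lambda>s. ln (K s)) has_real_derivative deriv K t / K t) (at t)"
  using K_pos[of t] by (auto intro!: derivative_eq_intros K_has_derivative)

lemma K_inj: "inj_on K {0..<1}"
  using K_strict_mono by (force intro!: linorder_inj_onI)

lemma K_surj:
  assumes "0 \<le> y"
  obtains x where "x \<in> {0..<1}" "K x = y"
proof -
  obtain t where t: "t \<in> {0..<1}" "y < K t" using K_unbounded by blast
  have "\<exists>x\<ge>0. x \<le> t \<and> K x = y"
    using t assms K_0 by (intro IVT' continuous_on_subset[OF K_continuous]) auto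
  then obtain x where "0 \<le> x" "x \<le> t" "K x = y" by blast
  then show ?thesis using t by (intro that[of x]) auto
qed

lemma flow_eqI: "x \<in> {0..<1} \<Longrightarrow> K x = \<theta> * K t \<Longrightarrow> flow \<theta> t = x"
  unfolding flow_def using inv_into_f_f[OF K_inj, of x] by simp

lemma
  assumes "0 \<le> \<theta>" "t \<in> {0..<1}"
  shows flow_in_unit: "flow \<theta> t \<in> {0..<1}"
    and K_flow: "K (flow \<theta> t) = \<theta> * K t"
proof -
  have "0 \<le> \<theta> * K t" using assms K_nonneg by simp
  then obtain x where "x \<in> {0..<1}" "K x = \<theta> * K t" by (rule K_surj)
  with flow_eqI[OF this] show "flow \<theta> t \<in> {0..<1}" "K (flow \<theta> t) = \<theta> * K t" by auto
qed

lemma K_less_iff: "s \<in> {0..<1} \<Longrightarrow> t \<in> {0..<1} \<Longrightarrow> K s < K t \<longleftrightarrow> s < t"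
  using K_strict_mono[of s t] K_mono[of t s] by force

lemma ln_K_unbounded: "\<exists>t. 1/2 < t \<and> t < 1 \<and> B < ln (K t)"
proof -
  \<comment> \<open>Including \<open>K (1/2)\<close> in the threshold forces \<open>t\<close> beyond
    1/2.\<close>
  obtain t where t: "t \<in> {0..<1}" "max (exp B) (K (1/2)) < K t" using K_unbounded by blast
  then have "1/2 < t" using K_less_iff[of "1/2" t] by auto
  moreover have "B < ln (K t)"
    using t K_pos[of t] \<open>1/2 < t\<close> by (subst ln_exp[symmetric], subst ln_less_cancel_iff) auto
  ultimately show ?thesis using t by auto
qed

lemma flow_less:
  assumes "0 \<le> \<theta>" "\<theta> < 1" "0 < t" "t < 1"
  shows "flow \<theta> t < t"
  using K_less_iff[of "flow \<theta> t" t] flow_in_unit[of \<theta> t] K_flow[of \<theta> t] K_pos[of t] assms by auto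

lemma flow_pos:
  assumes "0 < \<theta>" "0 < t" "t < 1"
  shows "0 < flow \<theta> t"
  using K_less_iff[of 0 "flow \<theta> t"] flow_in_unit[of \<theta> t] K_flow[of \<theta> t] K_pos[of t] assms K_0 by auto

lemma flow_at_0 [simp]: "flow \<theta> 0 = 0"
  by (rule flow_eqI) (auto simp: K_0)

lemma flow_1: "t \<in> {0..<1} \<Longrightarrow> flow 1 t = t"
  by (rule flow_eqI) auto

lemma flow_flow:
  assumes "0 \<le> \<theta>" "0 \<le> \<eta>" "t \<in> {0..<1}"
  shows "flow \<theta> (flow \<eta> t) = flow (\<theta> * \<eta>) t"
  using assms flow_in_unit[of \<eta> t] flow_in_unit[of \<theta> "flow \<eta> t"] K_flow
  by (intro flow_eqI[symmetric]) auto

text \<open>Strict monotonicity pulls convergence back through \<open>K\<close>: a threshold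
  \<open>a\<close> inside the unit interval is compared through \<open>K a\<close>, and a threshold
  outside it is passed trivially.\<close>

lemma tendsto_of_K:
  assumes "\<forall>\<^sub>F n in F. x n \<in> {0..<1}" "y \<in> {0..<1}" "((\<lambda>n. K (x n)) \<longlongrightarrow> K y) F"
  shows "(x \<longlongrightarrow> y) F"
proof (rule order_tendstoI)
  fix a assume a: "a < y"
  show "\<forall>\<^sub>F n in F. a < x n"
  proof (cases "0 \<le> a")
    case True
    then have "K a < K y" using a assms(2) K_strict_mono by auto
    then have "\<forall>\<^sub>F n in F. K a < K (x n)" using assms(3) by (rule order_tendstoD(1)[rotated])
    with assms(1) show ?thesis
      by eventually_elim (use True a assms(2) K_less_iff[of a] in auto)
  next
    case False
    with assms(1) show ?thesis by (auto elim: eventually_mono)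
  qed
next
  fix a assume a: "y < a"
  show "\<forall>\<^sub>F n in F. x n < a"
  proof (cases "a < 1")
    case True
    then have "K y < K a" using a assms(2) K_strict_mono by auto
    then have "\<forall>\<^sub>F n in F. K (x n) < K a" using assms(3) by (rule order_tendstoD(2)[rotated])
    with assms(1) show ?thesis
      by eventually_elim (use True a assms(2) K_less_iff[of _ a] in auto)
  next
    case False
    with assms(1) show ?thesis by (auto elim: eventually_mono)
  qed
qed

lemma flow_tendsto:
  assumes "(\<theta> \<longlongrightarrow> \<eta>) F" "\<forall>\<^sub>F n in F. 0 \<le> \<theta> n" "0 \<le> \<eta>" "t \<in> {0..<1}"
  shows "((\<lambda>n. flow (\<theta> n) t) \<longlongrightarrow> flow \<eta> t) F"
proof (rule tendsto_of_K)
  show "\<forall>\<^sub>F n in F. flow (\<theta> n) t \<in> {0..<1}"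
    using assms(2) by eventually_elim (use assms flow_in_unit in auto)
  show "flow \<eta> t \<in> {0..<1}" using assms flow_in_unit by auto
  have "((\<lambda>n. \<theta> n * K t) \<longlongrightarrow> \<eta> * K t) F"
    using assms by (intro tendsto_intros)
  moreover have "\<forall>\<^sub>F n in F. \<theta> n * K t = K (flow (\<theta> n) t)"
    using assms(2) by eventually_elim (use assms K_flow in auto)
  ultimately show "((\<lambda>n. K (flow (\<theta> n) t)) \<longlongrightarrow> K (flow \<eta> t)) F"
    using assms K_flow[of \<eta> t] by (auto elim: Lim_transform_eventually)
qed

lemma K_ratio_0:
  assumes "(x \<longlongrightarrow> 0) F" "\<forall>\<^sub>F n in F. 0 < x n"
  shows "((\<lambda>n. K (x n) / x n) \<longlongrightarrow> 1) F"
  using K_ratio by (rule filterlim_compose) (use assms in \<open>auto simp: filterlim_at elim: eventually_mono\<close>)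

text \<open>This is the absence of mass at infinity in limits of pgfs.\<close>

lemma flow_onto:
  assumes "0 < \<theta>" "s < 1"
  shows "\<exists>t\<in>{0..<1}. s \<le> flow \<theta> t"
proof -
  define r where "r = max 0 s"
  have r: "r \<in> {0..<1}" using assms by (auto simp: r_def)
  obtain t where t: "t \<in> {0..<1}" "K t = K r / \<theta>"
    using K_surj[of "K r / \<theta>"] r assms K_nonneg[of r] by auto
  then have "flow \<theta> t = r" using r assms by (intro flow_eqI) auto
  moreover have "s \<le> r" by (simp add: r_def)
  ultimately show ?thesis using t(1) by (intro bexI[of _ t]) auto
qed

text \<open>Because \<open>K x / x\<close> tends to 1 at 0, the equation
  \<open>K (pgf N t) = \<theta> * K t\<close> forces \<open>pgf N t / t\<close> to tend to \<theta>,
  while this ratio also tends to the coefficient at 1.\<close>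

lemma pmf_1_of_flow:
  assumes "N \<in> positive_rvs" "0 < \<theta>" "\<And>t. t \<in> {0..<1} \<Longrightarrow> pgf N t = flow \<theta> t"
  shows "pmf N 1 = \<theta>"
proof -
  have unit: "\<forall>\<^sub>F t in at_right 0. t \<in> {0<..<1::real}"
    by (auto simp: eventually_at_right_field intro!: exI[of _ 1])
  have "((\<lambda>t. pgf N t) \<longlongrightarrow> pgf N 0) (at_right 0)"
    using continuous_on_pgf[of N]
    by (metis continuous_on_Icc_at_rightD zero_less_one)
  then have "((\<lambda>t. pgf N t) \<longlongrightarrow> 0) (at_right 0)"
    using assms by (simp add: positive_rvs_def)
  then have *: "((\<lambda>t. K (pgf N t) / pgf N t) \<longlongrightarrow> 1) (at_right 0)"
    by (rule K_ratio_0) (use unit pgf_pos in \<open>auto elim!: eventually_mono\<close>)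
  have "((\<lambda>t. \<theta> * (K t / t) / (K (pgf N t) / pgf N t)) \<longlongrightarrow> \<theta> * 1 / 1) (at_right 0)"
    by (intro tendsto_intros K_ratio *) simp
  moreover have "\<forall>\<^sub>F t in at_right 0. \<theta> * (K t / t) / (K (pgf N t) / pgf N t) = pgf N t / t"
    using unit
  proof eventually_elim
    case (elim t)
    then have "K (pgf N t) = \<theta> * K t" using assms K_flow[of \<theta> t] by auto
    then show ?case using assms elim K_pos[of t] pgf_pos[of t N] by (simp add: field_simps)
  qed
  ultimately have "((\<lambda>t. pgf N t / t) \<longlongrightarrow> \<theta>) (at_right 0)"
    by (auto elim: Lim_transform_eventually)
  then show ?thesis
    using pgf_ratio_tendsto[OF assms(1)] tendsto_unique trivial_limit_at_right_real by blast
qed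

end

subsection \<open>Semigroups of generating functions and their generators\<close>

context linearizer
begin

text \<open>The derivative of \<open>ln K\<close> is \<open>1 / (s * (1 - pgf q s))\<close>, so the
  mean value theorem gives the decrease exactly as
  \<open>e * (t / z) * ((1 - pgf q t) / (1 - pgf q z))\<close> with \<open>z\<close> between
  \<open>g\<close> and \<open>t\<close>. The upper bound uses \<open>(1 - e) * t \<le> g\<close>,
  the lower one convexity of the pgf.\<close>

lemma euler_step:
  assumes q: "q \<in> positive_rvs" "\<And>t. 0 < t \<Longrightarrow> t < 1 \<Longrightarrow> K t = t * deriv K t * (1 - pgf q t)"
    and e: "0 < e" "e < 1" and t: "0 < t" "t < 1"
  defines "g \<equiv> (1 - e) * t + e * t * pgf q t"
  shows "0 < g" "g < t" "e * (1 - e / (1 - t)) \<le> ln (K t) - ln (K g)" "ln (K t) - ln (K g) \<le> e / (1 - e)"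
proof -
  have lt1: "0 \<le> pgf q s" "pgf q s < 1" if "0 < s" "s < 1" for s
    using pgf_in_unit[OF q(1), of s] that by auto
  have g_ge: "(1 - e) * t \<le> g" using lt1[OF t] e t by (simp add: g_def)
  have g_eq: "t - g = e * t * (1 - pgf q t)" by (simp add: g_def algebra_simps)
  show g0: "0 < g" using g_ge e t by (smt (verit) mult_pos_pos)
  have "0 < e * t * (1 - pgf q t)" using lt1[OF t] e t by simp
  with g_eq show gt: "g < t" by simp
  have dL: "((\<lambda>s. ln (K s)) has_real_derivative 1 / (s * (1 - pgf q s))) (at s)" if "0 < s" "s < 1" for s
  proof -
    have "deriv K s / K s = 1 / (s * (1 - pgf q s))"
      using q(2)[OF that] K_deriv_pos[OF that] lt1[OF that] that by simp
    then show ?thesis using ln_K_has_derivative[OF that] by simp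
  qed
  obtain z where z: "g < z" "z < t" "ln (K t) - ln (K g) = (t - g) * (1 / (z * (1 - pgf q z)))"
    using MVT2[OF gt, of "\<lambda>s. ln (K s)" "\<lambda>s. 1 / (s * (1 - pgf q s))"] dL g0 t by force
  have z01: "0 < z" "z < 1" using z g0 t by auto
  note pz = lt1[OF z01] and pt = lt1[OF t]
  have diff: "ln (K t) - ln (K g) = e * (t / z) * ((1 - pgf q t) / (1 - pgf q z))"
    using z(3) g_eq by simp
  have "(1 - pgf q t) / (1 - pgf q z) \<le> 1"
    using pgf_mono[of z t q] z z01 t pz by simp
  moreover have "t / z \<le> 1 / (1 - e)"
  proof -
    have "(1 - e) * t \<le> z" using g_ge z by simp
    then show ?thesis using z01 e by (simp add: field_simps)
  qed
  ultimately have "(t / z) * ((1 - pgf q t) / (1 - pgf q z)) \<le> 1 / (1 - e) * 1"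
    using z01 t e pt pz by (intro mult_mono) auto
  then show "ln (K t) - ln (K g) \<le> e / (1 - e)"
    using mult_left_mono[of _ _ e] e unfolding diff mult.assoc by fastforce
  \<comment> \<open>The right-hand side is \<open>1 - (t - z) / (1 - z)\<close>; here
    \<open>t - z \<le> e\<close>, and \<open>1 - z\<close> exceeds \<open>1 - t\<close>. Monotone
    secant slopes then compare it with the quotient of the \<open>1 - pgf q\<close> values.\<close>
  have "1 - e / (1 - t) \<le> (1 - t) / (1 - z)"
  proof -
    have "t - z \<le> e"
    proof -
      have "t - z \<le> t - g" using z by simp
      also have "\<dots> = e * (t * (1 - pgf q t))" using g_eq by simp
      also have "\<dots> \<le> e" using e t pt by (intro mult_left_le mult_le_one) auto
      finally show ?thesis .
    qed
    then have "(t - z) / (1 - z) \<le> e / (1 - t)"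
      using z z01 t e by (intro frac_le) auto
    then show ?thesis using z01 by (simp add: field_simps)
  qed
  also have "\<dots> \<le> (1 - pgf q t) / (1 - pgf q z)"
    using pgf_secant_slope_mono[of z t q] z z01 t pz by (simp add: field_simps)
  also have "\<dots> \<le> (t / z) * ((1 - pgf q t) / (1 - pgf q z))"
    using mult_right_mono[of 1 "t / z" "(1 - pgf q t) / (1 - pgf q z)"] z z01 pt pz by simp
  finally show "e * (1 - e / (1 - t)) \<le> ln (K t) - ln (K g)"
    using mult_left_mono[of _ _ e] e unfolding diff mult.assoc by fastforce
qed

text \<open>The iterates never exceed \<open>t\<close>, and the lower bound of a single step is
  worst at the largest argument; so the bounds taken at \<open>t\<close> serve for all steps and
  simply add up.\<close>

lemma euler_iterate:
  fixes n :: nat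
  assumes q: "q \<in> positive_rvs" "\<And>t. 0 < t \<Longrightarrow> t < 1 \<Longrightarrow> K t = t * deriv K t * (1 - pgf q t)"
    and e: "0 < e" "e < 1" and t: "0 < t" "t < 1"
  defines "g \<equiv> \<lambda>n. (pgf (euler_pmf e q) ^^ n) t"
  shows "0 < g n \<and> g n \<le> t \<and> n * (e * (1 - e / (1 - t))) \<le> ln (K t) - ln (K (g n)) \<and>
    ln (K t) - ln (K (g n)) \<le> n * (e / (1 - e))"
proof (induction n)
  case 0
  then show ?case using t by (simp add: g_def)
next
  case (Suc n)
  have gn: "0 < g n" "g n < 1" using Suc t by auto
  have g: "g (Suc n) = (1 - e) * g n + e * g n * pgf q (g n)"
    using gn e by (simp add: g_def pgf_euler_pmf)
  note st = euler_step[OF q e gn, folded g]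
  have "e / (1 - g n) \<le> e / (1 - t)"
    using Suc t e by (intro divide_left_mono mult_pos_pos) auto
  then have "e * (1 - e / (1 - t)) \<le> e * (1 - e / (1 - g n))"
    using e by simp
  then show ?case using st Suc by (auto simp: distrib_right add_divide_distrib)
qed

text \<open>
  The Euler scheme of \<open>y' = - y (1 - pgf q y)\<close>, whose flow is \<open>flow (exp (- u))\<close>, iterates the pgf
  \<open>(1 - e) t + e t pgf q t\<close>; pgfs are closed under composition and, up to loss of mass, under limits.
\<close>

theorem flow_is_pgf:
  assumes q: "q \<in> positive_rvs" "\<And>t. 0 < t \<Longrightarrow> t < 1 \<Longrightarrow> K t = t * deriv K t * (1 - pgf q t)"
    and \<theta>: "0 < \<theta>" "\<theta> \<le> 1"
  shows "is_pgf (flow \<theta>)"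
proof (cases "\<theta> = 1")
  case True
  then show ?thesis
    unfolding is_pgf_def by (intro bexI[of _ N_I] N_I_positive) (auto simp: flow_1)
next
  case False
  \<comment> \<open>The running time of the flow: \<theta> is \<open>exp (- u)\<close>.\<close>
  define u where "u = - ln \<theta>"
  have u: "0 < u" using \<theta> False by (simp add: u_def)
  \<comment> \<open>The shift by \<open>n0\<close> makes every step length
    \<open>u / (n + n0)\<close> smaller than 1, as a mixing probability has to be, while
    \<open>n + n0\<close> steps still take exactly the time \<open>u\<close>.\<close>
  obtain n0 :: nat where n0: "u < n0" using reals_Archimedean2 by blast
  define e where "e n = u / real (n + n0)" for n
  have e: "0 < e n" "e n < 1" "real (n + n0) * e n = u" for n
    using u n0 by (auto simp: e_def)
  have e_lim: "e \<longlonglongrightarrow> 0"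
    unfolding e_def by (rule LIMSEQ_ignore_initial_segment[OF lim_const_over_n])
  define M where "M n = iterate_pmf (euler_pmf (e n) q) (n + n0)" for n
  have M: "M n \<in> positive_rvs" for n
    unfolding M_def using q(1) e[of n]
    by (intro iterate_pmf_positive positive_rvsI)
      (simp add: pgf_euler_pmf less_imp_le positive_rvs_def del: pgf_0)
  have lim: "(\<lambda>n. pgf (M n) t) \<longlonglongrightarrow> flow \<theta> t" if t: "0 \<le> t" "t < 1" for t
  proof (cases "t = 0")
    case True
    then show ?thesis using M by (simp add: positive_rvs_def)
  next
    case False
    with t have t0: "0 < t" by simp
    have pM: "pgf (M n) t = (pgf (euler_pmf (e n) q) ^^ (n + n0)) t" for n
      using t by (simp add: M_def pgf_iterate_pmf)
    have ei: "0 < pgf (M n) t \<and> pgf (M n) t \<le> t \<and> u * (1 - e n / (1 - t)) \<le> ln (K t) - ln (K (pgf (M n) t)) \<and>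
        ln (K t) - ln (K (pgf (M n) t)) \<le> u / (1 - e n)" for n
      using euler_iterate[OF q e(1)[of n] e(2)[of n] t0 t(2), of "n + n0"]
      unfolding pM mult.assoc[symmetric] times_divide_eq_right e(3) .
    have p01: "pgf (M n) t \<in> {0<..<1}" for n
      using ei[of n] t by auto
    have "(\<lambda>n. ln (K t) - ln (K (pgf (M n) t))) \<longlonglongrightarrow> u"
    proof (rule tendsto_sandwich)
      show "\<forall>\<^sub>F n in sequentially. u * (1 - e n / (1 - t)) \<le> ln (K t) - ln (K (pgf (M n) t))"
        using ei by simp
      show "\<forall>\<^sub>F n in sequentially. ln (K t) - ln (K (pgf (M n) t)) \<le> u / (1 - e n)"
        using ei by simp
      have "(\<lambda>n. u * (1 - e n / (1 - t))) \<longlonglongrightarrow> u * (1 - 0 / (1 - t))"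
        using t by (intro tendsto_intros e_lim) auto
      then show "(\<lambda>n. u * (1 - e n / (1 - t))) \<longlonglongrightarrow> u" by simp
      have "(\<lambda>n. u / (1 - e n)) \<longlonglongrightarrow> u / (1 - 0)"
        by (intro tendsto_intros e_lim) auto
      then show "(\<lambda>n. u / (1 - e n)) \<longlonglongrightarrow> u" by simp
    qed
    then have "(\<lambda>n. exp (ln (K t) - (ln (K t) - ln (K (pgf (M n) t))))) \<longlonglongrightarrow> exp (ln (K t) - u)"
      by (intro tendsto_intros)
    moreover have "exp (ln (K t) - u) = K (flow \<theta> t)"
      using K_pos[OF t0 t(2)] \<theta> t K_flow[of \<theta> t] by (simp add: u_def exp_add)
    moreover have "exp (ln (K t) - (ln (K t) - ln (K (pgf (M n) t)))) = K (pgf (M n) t)" for n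
      using K_pos p01[of n] by simp
    ultimately have "(\<lambda>n. K (pgf (M n) t)) \<longlonglongrightarrow> K (flow \<theta> t)" by simp
    moreover have "\<forall>\<^sub>F n in sequentially. pgf (M n) t \<in> {0..<1}"
      using p01 by (simp add: less_imp_le)
    moreover have "flow \<theta> t \<in> {0..<1}"
      using \<theta> t by (intro flow_in_unit) auto
    ultimately show ?thesis
      by (rule tendsto_of_K[rotated 2])
  qed
  have sm: "summable (\<lambda>i. pmf (M n) i * t ^ i)" if "0 \<le> t" "t < 1" for n t
    using that by (intro summable_pgf) auto
  have "\<exists>c r. strict_mono (r :: nat \<Rightarrow> nat) \<and> (\<forall>i. 0 \<le> c i \<and> (\<lambda>n. pmf (M (r n)) i) \<longlonglongrightarrow> c i) \<and>
      (\<forall>t. 0 \<le> t \<and> t < 1 \<longrightarrow> summable (\<lambda>i. c i * t ^ i) \<and> flow \<theta> t = (\<Sum>i. c i * t ^ i))"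
    by (rule nonneg_powser_limit[where a="\<lambda>n. pmf (M n)" and f="flow \<theta>"]) (fact pmf_nonneg sm lim[unfolded pgf_def])+
  then obtain c r where "\<forall>i. 0 \<le> c i \<and> (\<lambda>n. pmf (M (r n)) i) \<longlonglongrightarrow> c i"
    "\<forall>t. 0 \<le> t \<and> t < 1 \<longrightarrow> summable (\<lambda>i. c i * t ^ i) \<and> flow \<theta> t = (\<Sum>i. c i * t ^ i)"
    by (elim exE conjE) (rule that)
  then have c: "\<And>i. 0 \<le> c i" "\<And>i. (\<lambda>n. pmf (M (r n)) i) \<longlonglongrightarrow> c i"
    "\<And>t. 0 \<le> t \<Longrightarrow> t < 1 \<Longrightarrow> summable (\<lambda>i. c i * t ^ i)"
    "\<And>t. 0 \<le> t \<Longrightarrow> t < 1 \<Longrightarrow> flow \<theta> t = (\<Sum>i. c i * t ^ i)"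
    by simp_all
  have "(\<lambda>n. pmf (M (r n)) 0) \<longlonglongrightarrow> 0"
    using M by (simp add: positive_rvs_def)
  then have c0: "c 0 = 0" using c(2) LIMSEQ_unique by blast
  show ?thesis
  proof (rule is_pgf_of_coefficients[OF c(1) c0 c(3,4)])
    show "flow \<theta> t \<le> 1" if "0 \<le> t" "t < 1" for t
      using flow_in_unit[of \<theta> t] \<theta> that by auto
    show "\<exists>t\<in>{0..<1}. s \<le> flow \<theta> t" if "s < 1" for s
      using flow_onto \<theta> that by blast
  qed
qed

text \<open>Since \<open>K (flow \<theta> t) - K t = - (1 - \<theta>) * K t\<close>, the quotient is
  \<open>K t\<close> divided by a difference quotient of \<open>K\<close> at \<open>t\<close>.
  Strict decrease of the flow for \<theta> < 1 keeps that difference quotient away from a zero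
  denominator.\<close>

lemma infinitesimal_generator:
  assumes t: "0 < t" "t < 1" and \<theta>: "\<theta> \<longlonglongrightarrow> 1" "\<And>n. 0 < \<theta> n" "\<And>n. \<theta> n < 1"
  shows "(\<lambda>n. (t - flow (\<theta> n) t) / (1 - \<theta> n)) \<longlonglongrightarrow> K t / deriv K t"
proof -
  have fl: "(\<lambda>n. flow (\<theta> n) t) \<longlonglongrightarrow> t"
    using flow_tendsto[OF \<theta>(1), of t] flow_1[of t] \<theta>(2) t by (simp add: less_imp_le)
  have "((\<lambda>s. (K s - K t) / (s - t)) \<longlongrightarrow> deriv K t) (at t)"
    using K_has_derivative[OF t] by (simp add: has_field_derivative_iff)
  then have "(\<lambda>n. (K (flow (\<theta> n) t) - K t) / (flow (\<theta> n) t - t)) \<longlonglongrightarrow> deriv K t"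
  proof (rule filterlim_compose)
    show "filterlim (\<lambda>n. flow (\<theta> n) t) (at t) sequentially"
      unfolding filterlim_at using fl flow_less[of "\<theta> _" t] \<theta>(2,3) t
      by (auto simp: less_imp_le intro!: always_eventually less_imp_neq)
  qed
  then have "(\<lambda>n. K t / ((K (flow (\<theta> n) t) - K t) / (flow (\<theta> n) t - t))) \<longlonglongrightarrow> K t / deriv K t"
    using K_deriv_pos[OF t] by (intro tendsto_intros) auto
  moreover have "K t / ((K (flow (\<theta> n) t) - K t) / (flow (\<theta> n) t - t)) = (t - flow (\<theta> n) t) / (1 - \<theta> n)" for n
    using K_flow[of "\<theta> n" t] K_pos[OF t] \<theta>(2,3)[of n] t flow_less[of "\<theta> n" t]
    by (simp add: less_imp_le field_simps)
  ultimately show ?thesis by simp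
qed

text \<open>The approximating pgfs belong to \<open>N - 1\<close> conditioned on
  \<open>N > 1\<close>. Mass could escape in the limit only if \<phi> stayed below some
  \<open>s < 1\<close>; then \<open>(ln K)' = 1 / (t * (1 - \<phi> t))\<close> would be bounded on
  the right half of the interval, and so would \<open>K\<close>.\<close>

theorem generator_is_pgf:
  assumes "\<And>\<theta>. 0 < \<theta> \<Longrightarrow> \<theta> \<le> 1 \<Longrightarrow> is_pgf (flow \<theta>)"
  shows "is_pgf (\<lambda>t. if t = 0 then 0 else 1 - K t / (t * deriv K t))"
proof -
  \<comment> \<open>The offset 2 keeps the parameters strictly between 0 and 1, starting from
    1/2.\<close>
  define \<theta> where "\<theta> n = 1 - 1 / real (n + 2)" for n
  have \<theta>: "0 < \<theta> n" "\<theta> n < 1" for n by (auto simp: \<theta>_def)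
  have "(\<lambda>n. 1 - 1 / real (n + 2)) \<longlonglongrightarrow> 1 - 0"
    by (intro tendsto_intros LIMSEQ_ignore_initial_segment[OF lim_const_over_n])
  then have \<theta>_lim: "\<theta> \<longlonglongrightarrow> 1" by (simp add: \<theta>_def[abs_def])
  have "\<exists>N. N \<in> positive_rvs \<and> (\<forall>t\<in>{0..<1}. pgf N t = flow (\<theta> n) t)" for n
    using assms[of "\<theta> n"] \<theta>[of n] by (auto simp: is_pgf_def)
  then obtain N where N: "N n \<in> positive_rvs" "\<And>t. t \<in> {0..<1} \<Longrightarrow> pgf (N n) t = flow (\<theta> n) t" for n
    by metis
  have p1: "pmf (N n) 1 = \<theta> n" for n
    using pmf_1_of_flow[OF N(1) \<theta>(1) N(2)] .
  define \<phi> where "\<phi> = (\<lambda>t. if t = 0 then 0 else 1 - K t / (t * deriv K t))"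
  \<comment> \<open>Probabilities of \<open>N n - 1\<close> given \<open>N n > 1\<close>: the event
    has probability \<open>1 - \<theta> n\<close>, and index 0 is cleared because it would carry the
    removed mass at 1.\<close>
  define a where "a n i = (if i = 0 then 0 else pmf (N n) (Suc i) / (1 - \<theta> n))" for n i
  have sm_eq: "summable (\<lambda>i. a n i * t ^ i) \<and> (\<Sum>i. a n i * t ^ i) = 1 - (t - flow (\<theta> n) t) / (1 - \<theta> n) / t"
    if t: "0 < t" "t < 1" for n t
  proof -
    let ?b = "\<lambda>i. pmf (N n) i - (if i = 1 then \<theta> n else 0)"
    have b: "(\<lambda>i. ?b i * t ^ i) sums (flow (\<theta> n) t - \<theta> n * t)"
    proof -
      have "(\<lambda>i. pmf (N n) i * t ^ i - (if i = 1 then \<theta> n * t else 0)) sums (pgf (N n) t - \<theta> n * t)"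
        using t by (intro sums_diff pgf_sums sums_single) auto
      moreover have "pmf (N n) i * t ^ i - (if i = 1 then \<theta> n * t else 0) = ?b i * t ^ i" for i
        by (simp add: algebra_simps)
      ultimately show ?thesis using N(2)[of t n] t by simp
    qed
    have b0: "?b 0 = 0" using N(1)[of n] by (simp add: positive_rvs_def)
    have bS: "?b (Suc i) / (1 - \<theta> n) = a n i" for i
      using p1[of n] by (auto simp: a_def)
    have "(\<lambda>i. ?b (Suc i) * t ^ Suc i) sums (flow (\<theta> n) t - \<theta> n * t)"
      using b b0 by (subst sums_Suc_iff) simp
    then have "(\<lambda>i. ?b (Suc i) * t ^ Suc i / (1 - \<theta> n) / t) sums ((flow (\<theta> n) t - \<theta> n * t) / (1 - \<theta> n) / t)"
      by (intro sums_divide)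
    moreover have "?b (Suc i) * t ^ Suc i / (1 - \<theta> n) / t = a n i * t ^ i" for i
      unfolding bS[symmetric] using t by simp
    ultimately have "(\<lambda>i. a n i * t ^ i) sums ((flow (\<theta> n) t - \<theta> n * t) / (1 - \<theta> n) / t)"
      by simp
    moreover have "(flow (\<theta> n) t - \<theta> n * t) / (1 - \<theta> n) / t = 1 - (t - flow (\<theta> n) t) / (1 - \<theta> n) / t"
      using \<theta>(2)[of n] t by (simp add: field_simps)
    ultimately show ?thesis by (simp add: sums_iff)
  qed
  have sm: "summable (\<lambda>i. a n i * t ^ i)" if "0 \<le> t" "t < 1" for n t
    using sm_eq[of t n] that by (cases "t = 0") auto
  have lim: "(\<lambda>n. \<Sum>i. a n i * t ^ i) \<longlonglongrightarrow> \<phi> t" if t: "0 \<le> t" "t < 1" for t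
  proof (cases "t = 0")
    case True
    have "(\<Sum>i. a n i * 0 ^ i) = 0" for n
      by (simp add: sums_unique[OF powser_sums_zero, symmetric] a_def)
    then show ?thesis using True by (simp add: \<phi>_def)
  next
    case False
    then have t0: "0 < t" using t by simp
    have "(\<lambda>n. 1 - (t - flow (\<theta> n) t) / (1 - \<theta> n) / t) \<longlonglongrightarrow> 1 - K t / deriv K t / t"
      using t0 by (intro tendsto_intros infinitesimal_generator[OF t0 t(2) \<theta>_lim \<theta>]) auto
    then show ?thesis using sm_eq[OF t0 t(2)] t0 by (simp add: \<phi>_def divide_divide_eq_left' mult.commute)
  qed
  have a0: "0 \<le> a n i" for n i using \<theta>(2)[of n] by (simp add: a_def)
  have "\<exists>c r. strict_mono (r :: nat \<Rightarrow> nat) \<and> (\<forall>i. 0 \<le> c i \<and> (\<lambda>n. a (r n) i) \<longlonglongrightarrow> c i) \<and>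
      (\<forall>t. 0 \<le> t \<and> t < 1 \<longrightarrow> summable (\<lambda>i. c i * t ^ i) \<and> \<phi> t = (\<Sum>i. c i * t ^ i))"
    by (rule nonneg_powser_limit[where a=a and f=\<phi>]) (fact a0 sm lim)+
  then obtain c r where "\<forall>i. 0 \<le> c i \<and> (\<lambda>n. a (r n) i) \<longlonglongrightarrow> c i"
    "\<forall>t. 0 \<le> t \<and> t < 1 \<longrightarrow> summable (\<lambda>i. c i * t ^ i) \<and> \<phi> t = (\<Sum>i. c i * t ^ i)"
    by (elim exE conjE) (rule that)
  then have c: "\<And>i. 0 \<le> c i" "\<And>i. (\<lambda>n. a (r n) i) \<longlonglongrightarrow> c i"
    "\<And>t. 0 \<le> t \<Longrightarrow> t < 1 \<Longrightarrow> summable (\<lambda>i. c i * t ^ i)"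
    "\<And>t. 0 \<le> t \<Longrightarrow> t < 1 \<Longrightarrow> \<phi> t = (\<Sum>i. c i * t ^ i)"
    by simp_all
  have c0: "c 0 = 0" using c(2)[of 0] by (simp add: a_def LIMSEQ_const_iff)
  have "is_pgf \<phi>"
  proof (rule is_pgf_of_coefficients[OF c(1) c0 c(3,4)])
    show "\<phi> t \<le> 1" if "0 \<le> t" "t < 1" for t
      using K_pos[of t] K_deriv_pos[of t] that by (auto simp: \<phi>_def less_imp_le)
    fix s :: real assume s: "s < 1"
    show "\<exists>t\<in>{0..<1}. s \<le> \<phi> t"
    proof (rule ccontr)
      assume "\<not> ?thesis"
      then have less: "\<phi> t < s" if "0 \<le> t" "t < 1" for t using that by force
      \<comment> \<open>A bound for \<open>deriv K z / K z = 1 / (z * (1 - \<phi> z))\<close> when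
        \<open>z > 1/2\<close> and \<open>\<phi> z < s\<close>; integrated over an interval shorter
        than 1 it also bounds the growth of \<open>ln K\<close>.\<close>
      let ?C = "2 / (1 - s)"
      have bound: "ln (K t) \<le> ln (K (1/2)) + ?C" if t: "1/2 < t" "t < 1" for t
      proof -
        obtain z where z: "1/2 < z" "z < t" "ln (K t) - ln (K (1/2)) = (t - 1/2) * (deriv K z / K z)"
          using MVT2[OF t(1), of "\<lambda>s. ln (K s)" "\<lambda>s. deriv K s / K s"]
            ln_K_has_derivative t by force
        have "1 - K z / (z * deriv K z) < s"
          using less[of z] z t by (simp add: \<phi>_def)
        then have "(1 - s) * (z * deriv K z) < K z"
          using K_deriv_pos[of z] z t by (simp add: field_simps)
        then have "(1 - s) * z * (deriv K z / K z) \<le> 1"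
          using K_pos[of z] z t by (simp add: field_simps)
        moreover have "(1 - s) * (1/2) * (deriv K z / K z) \<le> (1 - s) * z * (deriv K z / K z)"
          using K_pos[of z] K_deriv_pos[of z] z t s by (intro mult_right_mono mult_left_mono) auto
        ultimately have "(1 - s) * (1/2) * (deriv K z / K z) \<le> 1" by (rule order_trans[rotated])
        moreover have "x \<le> ?C" if "(1 - s) * (1/2) * x \<le> 1" for x
          using that s by (simp add: field_simps)
        ultimately have "deriv K z / K z \<le> ?C" by blast
        then have "(t - 1/2) * (deriv K z / K z) \<le> 1 * ?C"
          using K_pos[of z] K_deriv_pos[of z] z t by (intro mult_mono) auto
        then show ?thesis using z by simp
      qed
      obtain t where "1/2 < t" "t < 1" "ln (K (1/2)) + ?C < ln (K t)" using ln_K_unbounded by blast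
      with bound[of t] show False by simp
    qed
  qed
  then show ?thesis by (simp add: \<phi>_def)
qed

end

subsection \<open>The Koenigs function of a generating function\<close>

lemma pmf_1_comp_pmf:
  assumes "N \<in> positive_rvs" "M \<in> positive_rvs"
  shows "pmf (comp_pmf N M) 1 = pmf N 1 * pmf M 1"
proof -
  have "((\<lambda>t. pgf N (pgf M t)) has_real_derivative pmf N 1 * pmf M 1) (at 0)"
    using assms(2) pgf_has_derivative_at_0[of N]
    by (intro DERIV_chain2[OF _ pgf_has_derivative_at_0]) (simp add: positive_rvs_def)
  moreover have "\<forall>\<^sub>F t in nhds 0. pgf N (pgf M t) = pgf (comp_pmf N M) t"
    unfolding eventually_nhds_metric by (intro exI[of _ 1]) (simp add: pgf_comp_pmf)
  ultimately have "(pgf (comp_pmf N M) has_real_derivative pmf N 1 * pmf M 1) (at 0)"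
    by (subst (asm) DERIV_cong_ev[OF refl _ refl])
  then show ?thesis by (rule DERIV_unique[OF pgf_has_derivative_at_0])
qed

lemma pgf_ge_linear:
  assumes "0 \<le> t" "t \<le> 1"
  shows "pmf N 1 * t \<le> pgf N t"
  using pmf_mult_power_le_pgf[OF assms, of N 1] by simp

text \<open>All mass outside 1 sits at indices at least 2, where \<open>t ^ i\<close> is at most
  \<open>t\<^sup>2\<close>. This quadratic control near 0 is what makes the normalized iterates
  converge.\<close>

lemma pgf_le_quadratic:
  assumes N: "N \<in> positive_rvs" and t: "0 \<le> t" "t \<le> 1"
  shows "pgf N t \<le> t * (pmf N 1 + (1 - pmf N 1) * t)"
proof -
  let ?c = "\<lambda>i. if i = 1 then pmf N 1 * (t - t\<^sup>2) else 0"
  have "(\<lambda>i. pmf N i * t\<^sup>2 + ?c i) sums (1 * t\<^sup>2 + pmf N 1 * (t - t\<^sup>2))"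
    using summable_pmf_nat[of N] suminf_pmf_nat[of N]
    by (intro sums_add sums_mult2 sums_single) (simp add: sums_iff)
  moreover have "pmf N i * t ^ i \<le> pmf N i * t\<^sup>2 + ?c i" for i
  proof -
    consider "i = 0" | "i = 1" | "2 \<le> i" by linarith
    then show ?thesis
    proof cases
      case 1 then show ?thesis using N by (simp add: positive_rvs_def)
    next
      case 2 then show ?thesis by (simp add: algebra_simps)
    next
      case 3
      then have "pmf N i * t ^ i \<le> pmf N i * t\<^sup>2"
        using t by (intro mult_left_mono power_decreasing) auto
      then show ?thesis using 3 by simp
    qed
  qed
  ultimately have "pgf N t \<le> 1 * t\<^sup>2 + pmf N 1 * (t - t\<^sup>2)"
    using t by (intro sums_le[OF _ pgf_sums]) auto
  then show ?thesis by (simp add: algebra_simps power2_eq_square)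
qed

lemma pgf_onto:
  assumes "N \<in> positive_rvs" "s \<in> {0..<1}"
  obtains t where "t \<in> {0..<1}" "pgf N t = s"
proof -
  have "\<exists>t\<ge>0. t \<le> 1 \<and> pgf N t = s"
    using assms by (intro IVT' continuous_on_pgf) (auto simp: positive_rvs_def)
  then obtain t where "0 \<le> t" "t \<le> 1" "pgf N t = s" by blast
  moreover then have "t \<noteq> 1" using assms by auto
  ultimately show ?thesis using that[of t] by auto
qed

lemma pgf_iterate_in_unit: "N \<in> positive_rvs \<Longrightarrow> t \<in> {0..<1} \<Longrightarrow> (pgf N ^^ n) t \<in> {0..<1}"
  by (induction n) (auto dest: pgf_in_unit)

definition koenigs_pgf :: "nat pmf \<Rightarrow> real \<Rightarrow> real" where
  "koenigs_pgf N t = lim (\<lambda>n. (pgf N ^^ n) t / pmf N 1 ^ n)"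

text \<open>The bounds on the coefficient at 1 make 0 an attracting fixed point with nonzero
  multiplier, the setting of Koenigs' linearization.\<close>

locale proper_pgf =
  fixes N :: "nat pmf"
  assumes N: "N \<in> positive_rvs" and pmf_1: "0 < pmf N 1" "pmf N 1 < 1"
begin

abbreviation "a \<equiv> pmf N 1"

lemma contraction_factor:
  assumes "t \<in> {0..<1}"
  shows "0 \<le> a + (1 - a) * t" "a + (1 - a) * t < 1" "1 - (a + (1 - a) * t) = (1 - a) * (1 - t)"
proof -
  show eq: "1 - (a + (1 - a) * t) = (1 - a) * (1 - t)" by (simp add: algebra_simps)
  have "0 < (1 - a) * (1 - t)" using assms pmf_1 by simp
  with eq show "a + (1 - a) * t < 1" by linarith
  show "0 \<le> a + (1 - a) * t" using assms pmf_1 by simp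
qed

text \<open>By the quadratic bound one iteration multiplies \<open>x\<close> by at most
  \<open>a + (1 - a) * x\<close>; the iterates stay below \<open>t\<close>, so the factor at
  \<open>t\<close> works throughout.\<close>

lemma iterate_bound:
  assumes t: "t \<in> {0..<1}"
  shows "(pgf N ^^ n) t \<le> t * (a + (1 - a) * t) ^ n"
proof (induction n)
  case (Suc n)
  define x where "x = (pgf N ^^ n) t"
  have x: "x \<in> {0..<1}" unfolding x_def using N t by (rule pgf_iterate_in_unit)
  have \<rho>: "0 \<le> a + (1 - a) * t" "a + (1 - a) * t \<le> 1"
    using contraction_factor[OF t] by (auto intro: less_imp_le)
  have "x \<le> t"
    using Suc t \<rho> mult_left_le[of "(a + (1 - a) * t) ^ n" t] power_le_one[OF \<rho>, of n] by (simp add: x_def)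
  have "(pgf N ^^ Suc n) t \<le> x * (a + (1 - a) * x)"
    using pgf_le_quadratic[OF N, of x] x by (simp add: x_def)
  also have "\<dots> \<le> x * (a + (1 - a) * t)"
    using x \<open>x \<le> t\<close> pmf_1 by (intro mult_left_mono add_left_mono) auto
  also have "\<dots> \<le> (t * (a + (1 - a) * t) ^ n) * (a + (1 - a) * t)"
    using Suc \<rho> by (intro mult_right_mono) (simp_all add: x_def)
  finally show ?case by (simp add: mult_ac)
qed simp

lemma iterate_tendsto_0:
  assumes t: "t \<in> {0..<1}"
  shows "(\<lambda>n. (pgf N ^^ n) t) \<longlonglongrightarrow> 0"
proof (rule tendsto_sandwich)
  show "\<forall>\<^sub>F n in sequentially. 0 \<le> (pgf N ^^ n) t"
    using pgf_iterate_in_unit[OF N t] by simp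
  show "\<forall>\<^sub>F n in sequentially. (pgf N ^^ n) t \<le> t * (a + (1 - a) * t) ^ n"
    using iterate_bound[OF t] by simp
  have "(\<lambda>n. t * (a + (1 - a) * t) ^ n) \<longlonglongrightarrow> t * 0"
    using contraction_factor[OF t] by (intro tendsto_intros LIMSEQ_power_zero) simp
  then show "(\<lambda>n. t * (a + (1 - a) * t) ^ n) \<longlonglongrightarrow> 0" by simp
qed simp

text \<open>One iteration multiplies the normalized value by a factor between 1 and
  \<open>1 + C * x n\<close>, where \<open>C = (1 - a) / a\<close> and \<open>x n\<close> decays
  geometrically. The product of these factors is at most the exponential of a geometric series,
  whose sum gives \<open>t / (a * (1 - t))\<close>.\<close>

lemma normalized_iterate_bounds:
  assumes t: "t \<in> {0..<1}"
  shows "(pgf N ^^ n) t / a ^ n \<le> (pgf N ^^ Suc n) t / a ^ Suc n"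
    "(pgf N ^^ n) t / a ^ n \<le> t * exp (t / (a * (1 - t)))"
proof -
  define x where "x n = (pgf N ^^ n) t" for n
  have x: "x n \<in> {0..<1}" for n unfolding x_def using N t by (rule pgf_iterate_in_unit)
  show "(pgf N ^^ n) t / a ^ n \<le> (pgf N ^^ Suc n) t / a ^ Suc n"
    using pgf_ge_linear[of "x n" N] x[of n] pmf_1 by (simp add: x_def field_simps)
  define \<rho> where "\<rho> = a + (1 - a) * t"
  have \<rho>: "0 \<le> \<rho>" "\<rho> < 1" "1 - \<rho> = (1 - a) * (1 - t)"
    unfolding \<rho>_def using contraction_factor[OF t] .
  define C where "C = (1 - a) / a"
  have C: "0 \<le> C" using pmf_1 by (simp add: C_def)
  have step: "x n / a ^ n \<le> t * exp (C * t * (\<Sum>k<n. \<rho> ^ k))" for n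
  proof (induction n)
    case 0 then show ?case by (simp add: x_def)
  next
    case (Suc n)
    have "x (Suc n) / a ^ Suc n \<le> x n * (a + (1 - a) * x n) / a ^ Suc n"
      using pgf_le_quadratic[OF N, of "x n"] x[of n] pmf_1 by (intro divide_right_mono) (auto simp: x_def)
    also have "\<dots> = x n / a ^ n * (1 + C * x n)"
      using pmf_1 by (simp add: C_def field_simps)
    also have "\<dots> \<le> x n / a ^ n * exp (C * (t * \<rho> ^ n))"
    proof (intro mult_left_mono)
      have "1 + C * x n \<le> 1 + C * (t * \<rho> ^ n)"
        using iterate_bound[OF t, of n] C by (intro add_left_mono mult_left_mono) (auto simp: x_def \<rho>_def)
      also have "\<dots> \<le> exp (C * (t * \<rho> ^ n))" by (rule exp_ge_add_one_self)
      finally show "1 + C * x n \<le> exp (C * (t * \<rho> ^ n))" .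
      show "0 \<le> x n / a ^ n" using x[of n] pmf_1 by simp
    qed
    also have "\<dots> \<le> t * exp (C * t * (\<Sum>k<n. \<rho> ^ k)) * exp (C * (t * \<rho> ^ n))"
      using Suc by (intro mult_right_mono) auto
    also have "\<dots> = t * exp (C * t * (\<Sum>k<Suc n. \<rho> ^ k))"
      by (simp add: exp_add[symmetric] algebra_simps)
    finally show ?case .
  qed
  have "(\<Sum>k<n. \<rho> ^ k) \<le> (\<Sum>k. \<rho> ^ k)"
    using \<rho> by (intro sum_le_suminf summable_geometric) auto
  also have "\<dots> = 1 / (1 - \<rho>)" using \<rho> by (intro suminf_geometric) auto
  finally have "C * t * (\<Sum>k<n. \<rho> ^ k) \<le> C * t * (1 / (1 - \<rho>))"
    using C t by (intro mult_left_mono) auto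
  also have "\<dots> = t / (a * (1 - t))"
    using pmf_1 t by (simp add: C_def \<rho>(3))
  finally have "t * exp (C * t * (\<Sum>k<n. \<rho> ^ k)) \<le> t * exp (t / (a * (1 - t)))"
    using t by (intro mult_left_mono) auto
  with step[of n] show "(pgf N ^^ n) t / a ^ n \<le> t * exp (t / (a * (1 - t)))"
    by (simp add: x_def)
qed

lemma koenigs_pgf_LIMSEQ:
  assumes t: "t \<in> {0..<1}"
  shows "(\<lambda>n. (pgf N ^^ n) t / a ^ n) \<longlonglongrightarrow> koenigs_pgf N t"
proof -
  have "incseq (\<lambda>n. (pgf N ^^ n) t / a ^ n)"
    using normalized_iterate_bounds(1)[OF t] by (rule incseq_SucI)
  moreover have "\<forall>n. (pgf N ^^ n) t / a ^ n \<le> t * exp (t / (a * (1 - t)))"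
    using normalized_iterate_bounds(2)[OF t] by blast
  ultimately obtain L where "(\<lambda>n. (pgf N ^^ n) t / a ^ n) \<longlonglongrightarrow> L"
    by (rule incseq_convergent)
  then show ?thesis unfolding koenigs_pgf_def using limI by metis
qed

text \<open>The first normalized iterate and the uniform bound enclose the monotone limit; together
  they yield the normalization of \<open>K t / t\<close> at 0.\<close>

lemma koenigs_pgf_bounds:
  assumes t: "t \<in> {0..<1}"
  shows "t \<le> koenigs_pgf N t" "koenigs_pgf N t \<le> t * exp (t / (a * (1 - t)))"
proof -
  have "incseq (\<lambda>n. (pgf N ^^ n) t / a ^ n)"
    using normalized_iterate_bounds(1)[OF t] by (rule incseq_SucI)
  from incseq_le[OF this koenigs_pgf_LIMSEQ[OF t], of 0] show "t \<le> koenigs_pgf N t" by simp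
  show "koenigs_pgf N t \<le> t * exp (t / (a * (1 - t)))"
    using normalized_iterate_bounds(2)[OF t] by (intro tendsto_upperbound[OF koenigs_pgf_LIMSEQ[OF t]]) auto
qed

text \<open>Moving \<open>pgf M\<close> outside the iterates leaves \<open>pgf M x / x\<close> with
  \<open>x\<close> tending to 0, and this ratio tends to the coefficient of \<open>M\<close> at 1.
  For \<open>M = N\<close> it is Schroeder's functional equation.\<close>

lemma koenigs_pgf_commuting:
  assumes M: "M \<in> positive_rvs" and comm: "\<And>t. t \<in> {0..<1} \<Longrightarrow> pgf M (pgf N t) = pgf N (pgf M t)"
    and t: "t \<in> {0..<1}"
  shows "koenigs_pgf N (pgf M t) = pmf M 1 * koenigs_pgf N t"
proof (cases "t = 0")
  case True
  then show ?thesis using M koenigs_pgf_bounds[of 0] by (simp add: positive_rvs_def)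
next
  case False
  have x: "(pgf N ^^ n) t \<in> {0..<1}" for n using N t by (rule pgf_iterate_in_unit)
  have x0: "0 < (pgf N ^^ n) t" for n
    by (induction n) (use False t x in \<open>auto simp: pgf_pos less_imp_le\<close>)
  have it: "(pgf N ^^ n) (pgf M t) = pgf M ((pgf N ^^ n) t)" for n
    by (induction n) (use comm x in auto)
  have "filterlim (\<lambda>n. (pgf N ^^ n) t) (at_right 0) sequentially"
    using iterate_tendsto_0[OF t] x0 less_imp_neq[OF x0, symmetric] by (simp add: filterlim_at)
  then have "(\<lambda>n. pgf M ((pgf N ^^ n) t) / (pgf N ^^ n) t) \<longlonglongrightarrow> pmf M 1"
    by (rule filterlim_compose[OF pgf_ratio_tendsto[OF M]])
  then have "(\<lambda>n. pgf M ((pgf N ^^ n) t) / (pgf N ^^ n) t * ((pgf N ^^ n) t / a ^ n))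
      \<longlonglongrightarrow> pmf M 1 * koenigs_pgf N t"
    by (intro tendsto_mult koenigs_pgf_LIMSEQ t)
  moreover have "pgf M ((pgf N ^^ n) t) / (pgf N ^^ n) t * ((pgf N ^^ n) t / a ^ n) = (pgf N ^^ n) (pgf M t) / a ^ n" for n
    using x0[of n] it[of n] by simp
  ultimately have "(\<lambda>n. (pgf N ^^ n) (pgf M t) / a ^ n) \<longlonglongrightarrow> pmf M 1 * koenigs_pgf N t"
    by (simp only:)
  then show ?thesis
    using koenigs_pgf_LIMSEQ[OF pgf_in_unit[OF M t]] LIMSEQ_unique by blast
qed

text \<open>The normalized iterates are nonnegative power series, and the selection principle passes
  this on to their limit. It provides differentiability and, by the signs, a positive
  derivative.\<close>

lemma koenigs_pgf_powser:
  obtains c where "\<And>i. 0 \<le> c i" "\<And>t. 0 \<le> t \<Longrightarrow> t < 1 \<Longrightarrow> summable (\<lambda>i. c i * t ^ i)"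
    "\<And>t. 0 \<le> t \<Longrightarrow> t < 1 \<Longrightarrow> koenigs_pgf N t = (\<Sum>i. c i * t ^ i)"
proof -
  define b where "b n i = pmf (iterate_pmf N n) i / a ^ n" for n i
  have b: "(\<lambda>i. b n i * t ^ i) sums ((pgf N ^^ n) t / a ^ n)" if "0 \<le> t" "t < 1" for n t
    using sums_divide[OF pgf_sums[of t "iterate_pmf N n"], of "a ^ n"] that
    by (simp add: pgf_iterate_pmf b_def)
  have b_nonneg: "0 \<le> b n i" for n i using pmf_1 by (simp add: b_def)
  have b_summable: "summable (\<lambda>i. b n i * t ^ i)" if "0 \<le> t" "t < 1" for n t
    using b[OF that] sums_summable by blast
  have b_lim: "(\<lambda>n. \<Sum>i. b n i * t ^ i) \<longlonglongrightarrow> koenigs_pgf N t" if "0 \<le> t" "t < 1" for t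
    using koenigs_pgf_LIMSEQ[of t] b[OF that] that by (simp add: sums_iff)
  have "\<exists>c r. strict_mono (r :: nat \<Rightarrow> nat) \<and> (\<forall>i. 0 \<le> c i \<and> (\<lambda>n. b (r n) i) \<longlonglongrightarrow> c i) \<and>
    (\<forall>t. 0 \<le> t \<and> t < 1 \<longrightarrow> summable (\<lambda>i. c i * t ^ i) \<and> koenigs_pgf N t = (\<Sum>i. c i * t ^ i))"
    by (rule nonneg_powser_limit[where a=b and f="koenigs_pgf N"]) (fact b_nonneg b_summable b_lim)+
  then obtain c r where "\<forall>i. 0 \<le> c i \<and> (\<lambda>n. b (r n) i) \<longlonglongrightarrow> c i"
    "\<forall>t. 0 \<le> t \<and> t < 1 \<longrightarrow> summable (\<lambda>i. c i * t ^ i) \<and> koenigs_pgf N t = (\<Sum>i. c i * t ^ i)"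
    by (elim exE conjE) (rule that)
  then show ?thesis by (intro that[of c]) simp_all
qed

lemma koenigs_pgf_has_derivative:
  assumes t: "0 < t" "t < 1"
  shows "\<exists>D>0. (koenigs_pgf N has_real_derivative D) (at t)"
proof -
  obtain c where c: "\<And>i. 0 \<le> c i" "\<And>t. 0 \<le> t \<Longrightarrow> t < 1 \<Longrightarrow> summable (\<lambda>i. c i * t ^ i)"
    "\<And>t. 0 \<le> t \<Longrightarrow> t < 1 \<Longrightarrow> koenigs_pgf N t = (\<Sum>i. c i * t ^ i)"
    by (rule koenigs_pgf_powser) blast
  have c_summable: "summable (\<lambda>i. c i * z ^ i)" if "norm z < 1" for z
  proof -
    from that obtain s where "\<bar>z\<bar> < s" "s < 1" using dense[of "\<bar>z\<bar>" 1] by auto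
    then show ?thesis by (intro powser_inside[OF c(2)[of s]]) auto
  qed
  have "((\<lambda>z. \<Sum>i. c i * z ^ i) has_real_derivative (\<Sum>i. diffs c i * t ^ i)) (at t)"
    using t by (intro termdiffs_strong'[of 1] c_summable) auto
  then have "(koenigs_pgf N has_real_derivative (\<Sum>i. diffs c i * t ^ i)) (at t)"
    by (rule has_field_derivative_transform_within_open[of _ _ _ "{0<..<1}"]) (use t c in auto)
  moreover have "0 < (\<Sum>i. diffs c i * t ^ i)"
  proof -
    have "koenigs_pgf N 0 = c 0" using c(3)[of 0] powser_zero[of c] by simp
    then have "c 0 = 0" using koenigs_pgf_bounds[of 0] by simp
    have "\<exists>i. c (Suc i) \<noteq> 0"
    proof (rule ccontr)
      assume "\<not> ?thesis"
      with \<open>c 0 = 0\<close> have "c i = 0" for i by (cases i) auto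
      then have "koenigs_pgf N t = 0" using c(3)[of t] t by simp
      then show False using koenigs_pgf_bounds(1)[of t] t by simp
    qed
    then obtain i where "c (Suc i) \<noteq> 0" by blast
    then have "0 < c (Suc i)" using c(1)[of "Suc i"] by simp
    then have "0 < diffs c i * t ^ i" using t by (simp add: diffs_def)
    moreover have "summable (\<lambda>i. diffs c i * t ^ i)"
      using t by (intro termdiff_converges[of _ 1] c_summable) auto
    moreover have "0 \<le> diffs c i * t ^ i" for i
      using c(1) t by (simp add: diffs_def)
    ultimately show ?thesis by (intro suminf_pos2[of _ i])
  qed
  ultimately show ?thesis by blast
qed

sublocale linearizer "koenigs_pgf N"
proof
  show "koenigs_pgf N 0 = 0" using koenigs_pgf_bounds[of 0] by simp
  show "((\<lambda>t. koenigs_pgf N t / t) \<longlongrightarrow> 1) (at_right 0)"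
  proof (rule tendsto_sandwich)
    have "\<forall>\<^sub>F t in at_right 0. t \<in> {0<..<1::real}"
      by (auto simp: eventually_at_right_field intro!: exI[of _ 1])
    then show "\<forall>\<^sub>F t in at_right 0. 1 \<le> koenigs_pgf N t / t"
      by eventually_elim (use koenigs_pgf_bounds(1) in auto)
    have "\<forall>\<^sub>F t in at_right 0. t \<in> {0<..<1::real}"
      by (auto simp: eventually_at_right_field intro!: exI[of _ 1])
    then show "\<forall>\<^sub>F t in at_right 0. koenigs_pgf N t / t \<le> exp (t / (a * (1 - t)))"
      by eventually_elim (use koenigs_pgf_bounds(2) in \<open>auto simp: field_simps\<close>)
    have "((\<lambda>t. exp (t / (a * (1 - t)))) \<longlongrightarrow> exp (0 / (a * (1 - 0)))) (at_right 0)"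
      using pmf_1 by (intro tendsto_intros) auto
    then show "((\<lambda>t. exp (t / (a * (1 - t)))) \<longlongrightarrow> 1) (at_right 0)" by simp
  qed simp
  fix t :: real assume t: "0 < t" "t < 1"
  then obtain D where "0 < D" "(koenigs_pgf N has_real_derivative D) (at t)"
    using koenigs_pgf_has_derivative by blast
  then show "koenigs_pgf N differentiable at t" "0 < deriv (koenigs_pgf N) t"
    unfolding real_differentiable_def using DERIV_imp_deriv by (blast, metis)
next
  fix B
  \<comment> \<open>Walking backwards along the iteration: by Schroeder's equation a preimage of
    \<open>s\<close> under \<open>pgf N\<close> has the Koenigs value of \<open>s\<close> divided by
    \<open>a\<close>, and \<open>a < 1\<close>.\<close>
  have *: "\<exists>t\<in>{0..<1}. koenigs_pgf N t = koenigs_pgf N (1/2) / a ^ n" for n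
  proof (induction n)
    case (Suc n)
    then obtain s where s: "s \<in> {0..<1}" "koenigs_pgf N s = koenigs_pgf N (1/2) / a ^ n" by blast
    obtain t where t: "t \<in> {0..<1}" "pgf N t = s" using pgf_onto[OF N s(1)] .
    have "koenigs_pgf N s = a * koenigs_pgf N t"
      using koenigs_pgf_commuting[OF N _ t(1)] t(2) by simp
    then have "koenigs_pgf N t = koenigs_pgf N (1/2) / a ^ Suc n"
      using s(2) pmf_1 by (simp add: field_simps)
    with t(1) show ?case by blast
  next
    case 0
    show ?case by (intro bexI[of _ "1/2"]) simp_all
  qed
  obtain n where "B < koenigs_pgf N (1/2) / a ^ n"
  proof -
    have k: "0 < koenigs_pgf N (1/2)" using koenigs_pgf_bounds(1)[of "1/2"] by simp
    obtain n where "B / koenigs_pgf N (1/2) < (1 / a) ^ n"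
      using real_arch_pow[of "1 / a"] pmf_1 by auto
    then show ?thesis using k by (intro that[of n]) (simp add: field_simps)
  qed
  moreover obtain t where t: "t \<in> {0..<1}" "koenigs_pgf N t = koenigs_pgf N (1/2) / a ^ n"
    using * by blast
  ultimately have "B < koenigs_pgf N t" by (simp only:)
  with t(1) show "\<exists>t\<in>{0..<1}. B < koenigs_pgf N t" by blast
qed

end

subsection \<open>Stopping models\<close>

text \<open>The open set is pulled back along the line through \<open>x\<close> in direction 0;
  since \<open>0 < m\<close>, moving that coordinate does not leave the space.\<close>

lemma openin_Euclidean_space_perturb:
  assumes "openin (Euclidean_space m) U" "x \<in> U" "0 < m"
  shows "\<exists>e>0. \<forall>s. \<bar>s\<bar> < e \<longrightarrow> x(0 := x 0 + s) \<in> U"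
proof -
  obtain V where V: "open V" "U = V \<inter> {x. \<forall>i\<ge>m. x i = 0}"
    using assms(1) unfolding Euclidean_space_def openin_subtopology
    by (auto simp: euclidean_product_topology)
  define p where "p s = x(0 := x 0 + s)" for s :: real
  have "continuous_on UNIV p"
    unfolding p_def
  proof (rule continuous_on_coordinatewise_then_product)
    fix i show "continuous_on UNIV (\<lambda>s. (x(0 := x 0 + s)) i)"
      by (cases "i = 0") (auto intro!: continuous_intros)
  qed
  then have "open (p -` V)" using V(1) by (simp add: continuous_on_open_vimage)
  moreover have "0 \<in> p -` V" using assms(2) V(2) by (simp add: p_def)
  ultimately obtain e where e: "0 < e" "ball 0 e \<subseteq> p -` V" using open_contains_ball by blast
  have "p s \<in> U" if "\<bar>s\<bar> < e" for s
  proof -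
    have "s \<in> ball 0 e" using that by simp
    then have "p s \<in> V" using e(2) by blast
    moreover have "\<forall>i\<ge>m. p s i = 0" using assms V(2) by (auto simp: p_def)
    ultimately show ?thesis using V(2) by simp
  qed
  then show ?thesis using e(1) by (auto simp: p_def)
qed

text \<open>A nonempty open set in positive dimension has two points, and charts are injective, so
  at most one of their images is \<open>N_I\<close>.\<close>

lemma regular_stopping_model_nontrivial:
  assumes "regular_stopping_model \<N>"
  shows "\<exists>N\<in>\<N>. N \<noteq> N_I"
proof -
  obtain m \<A> where m: "0 < m" and fd: "finite_dim_structure m \<A> \<N>" and ne: "structure_interior m \<A> \<noteq> {}"
    using assms unfolding regular_stopping_model_def finite_dim_structure_def by blast
  obtain W P x where WP: "(W, P) \<in> \<A>" and x: "x \<in> Euclidean_space m interior_of W"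
    using ne unfolding structure_interior_def by blast
  obtain y where y: "y \<in> Euclidean_space m interior_of W" "y \<noteq> x"
  proof -
    obtain e where "0 < e" "\<forall>s. \<bar>s\<bar> < e \<longrightarrow> x(0 := x 0 + s) \<in> Euclidean_space m interior_of W"
      using openin_Euclidean_space_perturb[OF openin_interior_of x m] by blast
    then show ?thesis by (intro that[of "x(0 := x 0 + e / 2)"]) (auto simp: fun_eq_iff)
  qed
  have "inj_on P W \<and> P ` W \<subseteq> \<N>"
    using fd unfolding finite_dim_structure_def
  proof (elim conjE disjE exE)
    fix \<Theta> Q assume "\<A> = {(\<Theta>, Q)}" "global_parametrization m \<Theta> Q \<N>"
    then show ?thesis using WP by (auto simp: global_parametrization_def bij_betw_def)
  next
    assume atlas: "manifold_atlas m \<A> \<N>"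
    then obtain g where "homeomorphism W (pmf ` P ` W) (pmf \<circ> P) g"
      using WP unfolding manifold_atlas_def by blast
    then have "inj_on (pmf \<circ> P) W"
      by (intro inj_on_inverseI[of W g]) (simp add: homeomorphism_def)
    then have "inj_on P W" by (rule inj_on_imageI2)
    moreover have "P ` W \<subseteq> \<N>"
    proof -
      have "\<N> = (\<Union>(W, P)\<in>\<A>. P ` W)"
        using atlas unfolding manifold_atlas_def by (rule conjunct1)
      then show ?thesis using WP by auto
    qed
    ultimately show ?thesis by blast
  qed
  moreover have "x \<in> W" "y \<in> W" using x y(1) by (auto dest: subsetD[OF interior_of_subset])
  ultimately have "P x \<in> \<N>" "P y \<in> \<N>" "P x \<noteq> P y"
    using y(2) inj_on_eq_iff[of P W x y] by auto
  then show ?thesis by (cases "P x = N_I") (auto intro: bexI[of _ "P x"] bexI[of _ "P y"])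
qed

section \<open>Koenigs function and \<open>phi\<close> of a model, and when \<open>N_I\<close> can
  be included\<close>

lemma koenigs_eq:
  assumes "\<exists>N\<in>\<N>. N \<noteq> N_I"
  obtains N where "N \<in> \<N>" "N \<noteq> N_I" "koenigs \<N> = koenigs_pgf N"
proof -
  define N where "N = (SOME N. N \<in> \<N> \<and> N \<noteq> N_I)"
  have "N \<in> \<N> \<and> N \<noteq> N_I" unfolding N_def by (rule someI_ex[of "\<lambda>N. N \<in> \<N> \<and> N \<noteq> N_I"]) (use assms in blast)
  moreover have "koenigs \<N> = koenigs_pgf N"
    by (simp add: fun_eq_iff koenigs_def koenigs_pgf_def Let_def N_def[symmetric] deriv_pgf_0)
  ultimately show ?thesis using that by blast
qed

lemma proper_pgfI: "N \<in> positive_rvs \<Longrightarrow> N \<noteq> N_I \<Longrightarrow> pmf N 1 \<noteq> 0 \<Longrightarrow> proper_pgf N"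
  using eq_N_I[of N] pmf_nonneg[of N 1] pmf_le_1[of N 1]
  unfolding proper_pgf_def by fastforce

lemma phi_eq_generator: "t \<noteq> 0 \<Longrightarrow> phi \<N> t = 1 - koenigs \<N> t / (t * deriv (koenigs \<N>) t)"
  by (simp add: phi_def Let_def)

text \<open>The value of \<open>phi\<close> at 0 is a limit from the right, so continuity of the pgf
  extends the identity from the open interval to 0.\<close>

lemma phi_eqI:
  assumes q: "q \<in> positive_rvs"
    and eq: "\<And>t. 0 < t \<Longrightarrow> t < 1 \<Longrightarrow> 1 - koenigs \<N> t / (t * deriv (koenigs \<N>) t) = pgf q t"
    and t: "t \<in> {0..<1}"
  shows "phi \<N> t = pgf q t"
proof (cases "t = 0")
  case True
  have "(pgf q \<longlongrightarrow> pgf q 0) (at_right 0)"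
    using continuous_on_pgf[of q] by (metis continuous_on_Icc_at_rightD zero_less_one)
  moreover have "\<forall>\<^sub>F s in at_right 0. pgf q s = 1 - koenigs \<N> s / (s * deriv (koenigs \<N>) s)"
    using eq by (auto simp: eventually_at_right_field intro!: exI[of _ 1])
  ultimately have "((\<lambda>s. 1 - koenigs \<N> s / (s * deriv (koenigs \<N>) s)) \<longlongrightarrow> pgf q 0) (at_right 0)"
    by (rule Lim_transform_eventually)
  then have "Lim (at_right 0) (\<lambda>s. 1 - koenigs \<N> s / (s * deriv (koenigs \<N>) s)) = pgf q 0"
    by (intro tendsto_Lim) auto
  then show ?thesis using True by (simp add: phi_def Let_def)
next
  case False
  then show ?thesis using t eq by (simp add: phi_eq_generator)
qed

text \<open>A pgf without mass at 0 vanishes at 0 but is positive at 1/2. This rules out the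
  candidates \<open>inv_into\<close> of a vanishing Koenigs function.\<close>

lemma is_pgf_constant: "\<not> is_pgf (\<lambda>t. c)"
proof
  assume "is_pgf (\<lambda>t. c)"
  then obtain N where N: "N \<in> positive_rvs" "\<And>t. t \<in> {0..<1} \<Longrightarrow> c = pgf N t"
    by (auto simp: is_pgf_def)
  have "c = 0" using N(2)[of 0] N(1) by (simp add: positive_rvs_def)
  moreover have "0 < c" using N(2)[of "1/2"] pgf_pos[of "1/2" N] by simp
  ultimately show False by simp
qed

text \<open>From \<open>n = 1\<close> on the denominators are 0, and division by zero yields
  0.\<close>

lemma koenigs_pgf_degenerate:
  assumes "pmf N 1 = 0"
  shows "koenigs_pgf N = (\<lambda>_. 0)"
proof
  fix t
  have "(\<lambda>n. (pgf N ^^ n) t / pmf N 1 ^ n) \<longlonglongrightarrow> 0"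
    by (rule tendsto_eventually, rule eventually_mono[OF eventually_gt_at_top[of 0]]) (simp add: assms[unfolded One_nat_def])
  then show "koenigs_pgf N t = 0" unfolding koenigs_pgf_def by (rule limI)
qed

lemma (in linearizer) generator_eqD:
  assumes "1 - K t / (t * deriv K t) = x" "0 < t" "t < 1"
  shows "K t = t * deriv K t * (1 - x)"
  unfolding assms(1)[symmetric] using assms(2,3) K_deriv_pos[of t] by simp

theorem can_include_N_I_iff:
  assumes pos: "\<N> \<subseteq> positive_rvs" and ne: "\<exists>N\<in>\<N>. N \<noteq> N_I"
  shows "can_include_N_I \<N> \<longleftrightarrow> is_pgf (phi \<N>) \<and> phi \<N> 0 = 0"
proof -
  obtain N where N: "N \<in> \<N>" "N \<noteq> N_I" and K: "koenigs \<N> = koenigs_pgf N"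
    using koenigs_eq[OF ne] .
  have N_pos: "N \<in> positive_rvs" using N pos by blast
  show ?thesis
  proof (cases "pmf N 1 = 0")
    case True
    \<comment> \<open>In this degenerate case both sides fail: the candidates are constant
      functions, and \<open>phi\<close> has the value 1 at 0.\<close>
    then have K0: "koenigs \<N> = (\<lambda>_. 0)" using K koenigs_pgf_degenerate by simp
    have "\<not> can_include_N_I \<N>"
    proof
      assume "can_include_N_I \<N>"
      then have *: "\<forall>\<theta>\<in>{0<..1}. is_pgf (\<lambda>t. inv_into {0..<1} (\<lambda>_. 0 :: real) (\<theta> * 0 :: real) :: real)"
        unfolding can_include_N_I_def K0 .
      have "is_pgf (\<lambda>t. inv_into {0..<1} (\<lambda>_. 0 :: real) (1 * 0 :: real) :: real)"
        using bspec[OF *, of 1] by simp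
      then show False using is_pgf_constant by blast
    qed
    moreover have "phi \<N> 0 = 1"
      using tendsto_Lim[OF trivial_limit_at_right_real tendsto_const, of 0 "1::real"] by (simp add: phi_def K0)
    ultimately show ?thesis by simp
  next
    case False
    interpret proper_pgf N using N_pos N(2) False by (rule proper_pgfI)
    have can: "can_include_N_I \<N> \<longleftrightarrow> (\<forall>\<theta>\<in>{0<..1}. is_pgf (flow \<theta>))"
      by (simp add: can_include_N_I_def K flow_def[abs_def])
    show ?thesis
    proof
      assume "can_include_N_I \<N>"
      then have "is_pgf (\<lambda>t. if t = 0 then 0 else 1 - koenigs_pgf N t / (t * deriv (koenigs_pgf N) t))"
        using can by (intro generator_is_pgf) auto
      then obtain q where q: "q \<in> positive_rvs"
        "\<And>t. t \<in> {0..<1} \<Longrightarrow> (if t = 0 then 0 else 1 - koenigs_pgf N t / (t * deriv (koenigs_pgf N) t)) = pgf q t"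
        unfolding is_pgf_def by blast
      have "1 - koenigs \<N> t / (t * deriv (koenigs \<N>) t) = pgf q t" if "0 < t" "t < 1" for t
        using q(2)[of t] that by (simp add: K)
      then have phi: "phi \<N> t = pgf q t" if "t \<in> {0..<1}" for t
        using q(1) that by (intro phi_eqI)
      then have "is_pgf (phi \<N>)" using q(1) unfolding is_pgf_def by blast
      moreover have "phi \<N> 0 = 0" using phi[of 0] q(1) by (simp add: positive_rvs_def)
      ultimately show "is_pgf (phi \<N>) \<and> phi \<N> 0 = 0" ..
    next
      assume "is_pgf (phi \<N>) \<and> phi \<N> 0 = 0"
      then obtain q where q: "q \<in> positive_rvs" "\<And>t. t \<in> {0..<1} \<Longrightarrow> phi \<N> t = pgf q t"
        unfolding is_pgf_def by blast
      have "koenigs_pgf N t = t * deriv (koenigs_pgf N) t * (1 - pgf q t)" if "0 < t" "t < 1" for t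
        using q(2)[of t] that by (intro generator_eqD) (simp_all add: phi_eq_generator K)
      then show "can_include_N_I \<N>"
        unfolding can using q(1) by (auto intro!: flow_is_pgf)
    qed
  qed
qed

section \<open>Full models are determined by their law\<close>

lemma full_model_parameter:
  assumes "\<N> \<in> full_models" "\<theta> \<in> {0<..1}"
  obtains M where "M \<in> \<N>" "pmf M 1 = \<theta>"
proof -
  have "(\<lambda>N. pmf N 1) ` \<N> = {0<..1}" using assms(1) by (simp add: full_models_def bij_betw_def)
  then have "\<theta> \<in> (\<lambda>N. pmf N 1) ` \<N>" using assms(2) by simp
  then show ?thesis using that by (elim imageE) simp
qed

text \<open>Commutation with the element that \<open>koenigs\<close> selects gives
  \<open>K (pgf M t) = pmf M 1 * K t\<close> for every member \<open>M\<close>, which characterizes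
  the flow by injectivity of \<open>K\<close>.\<close>

lemma full_modelE:
  assumes "\<N> \<in> full_models"
  shows "linearizer (koenigs \<N>)"
    and "\<And>M t. M \<in> \<N> \<Longrightarrow> t \<in> {0..<1} \<Longrightarrow> pgf M t = linearizer.flow (koenigs \<N>) (pmf M 1) t"
proof -
  have reg: "regular_stopping_model \<N>" and bij: "bij_betw (\<lambda>N. pmf N 1) \<N> {0<..1}"
    using assms by (auto simp: full_models_def)
  have pos: "\<N> \<subseteq> positive_rvs" and closed: "closed_under_composition \<N>"
    using reg by (auto simp: regular_stopping_model_def)
  obtain N where NK: "N \<in> \<N>" "N \<noteq> N_I" and K: "koenigs \<N> = koenigs_pgf N"
    using koenigs_eq[OF regular_stopping_model_nontrivial[OF reg]] .
  have range: "0 < pmf M 1 \<and> pmf M 1 \<le> 1" if "M \<in> \<N>" for M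
    using bij that by (auto simp: bij_betw_def)
  interpret proper_pgf N using NK pos range[of N] by (intro proper_pgfI) auto
  show "linearizer (koenigs \<N>)" unfolding K by (rule linearizer_axioms)
  fix M and t :: real assume M: "M \<in> \<N>" and t: "t \<in> {0..<1}"
  have M_pos: "M \<in> positive_rvs" and N_rv: "N \<in> positive_rvs" using M NK pos by blast+
  have comp_in: "comp_pmf A B \<in> \<N>" if AB: "A \<in> \<N>" "B \<in> \<N>" for A B
  proof -
    obtain C where C: "C \<in> \<N>" "\<And>t. t \<in> {0..1} \<Longrightarrow> pgf C t = pgf A (pgf B t)"
      using closed AB unfolding closed_under_composition_def by blast
    have "C = comp_pmf A B"
      using C(2) by (intro pgf_inject) (simp add: pgf_comp_pmf)
    with C(1) show ?thesis by simp
  qed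
  have "pmf (comp_pmf M N) 1 = pmf (comp_pmf N M) 1"
    using M_pos N_rv by (simp only: pmf_1_comp_pmf mult.commute)
  then have comm: "comp_pmf M N = comp_pmf N M"
    using inj_onD[OF bij_betw_imp_inj_on[OF bij]] comp_in[OF M NK(1)] comp_in[OF NK(1) M] by blast
  have "pgf M (pgf N s) = pgf N (pgf M s)" if "s \<in> {0..<1}" for s
    using arg_cong[OF comm, of "\<lambda>X. pgf X s"] that by (simp add: pgf_comp_pmf)
  then have "koenigs_pgf N (pgf M t) = pmf M 1 * koenigs_pgf N t"
    using M_pos t by (intro koenigs_pgf_commuting)
  then have "flow (pmf M 1) t = pgf M t"
    using pgf_in_unit[OF M_pos t] by (intro flow_eqI)
  then show "pgf M t = linearizer.flow (koenigs \<N>) (pmf M 1) t" by (simp add: K)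
qed

text \<open>Every parameter in \<open>{0<..1}\<close> is taken by a member, whose pgf is the
  candidate for that parameter; so the criterion for including \<open>N_I\<close> makes
  \<open>phi\<close> a pgf. Uniqueness of coefficients justifies the description operator.\<close>

lemma phi_law_spec:
  assumes "\<N> \<in> full_models"
  shows "phi_law \<N> \<in> positive_rvs" "t \<in> {0..<1} \<Longrightarrow> pgf (phi_law \<N>) t = phi \<N> t"
proof -
  interpret linearizer "koenigs \<N>" using assms by (rule full_modelE)
  have reg: "regular_stopping_model \<N>" and bij: "bij_betw (\<lambda>N. pmf N 1) \<N> {0<..1}"
    using assms by (auto simp: full_models_def)
  have pos: "\<N> \<subseteq> positive_rvs" using reg by (auto simp: regular_stopping_model_def)
  have "is_pgf (flow \<theta>)" if \<theta>: "\<theta> \<in> {0<..1}" for \<theta>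
  proof -
    obtain M where "M \<in> \<N>" "pmf M 1 = \<theta>" using full_model_parameter[OF assms \<theta>] .
    then show ?thesis
      using full_modelE(2)[OF assms, of M] pos unfolding is_pgf_def by (intro bexI[of _ M]) auto
  qed
  then have "can_include_N_I \<N>" by (simp add: can_include_N_I_def flow_def[abs_def])
  then have "is_pgf (phi \<N>)"
    using can_include_N_I_iff[OF pos regular_stopping_model_nontrivial[OF reg]] by blast
  then obtain q where q: "q \<in> positive_rvs" "\<forall>t\<in>{0..<1}. phi \<N> t = pgf q t"
    unfolding is_pgf_def by blast
  have "phi_law \<N> \<in> positive_rvs \<and> (\<forall>t\<in>{0..<1}. pgf (phi_law \<N>) t = phi \<N> t)"
    unfolding phi_law_def
  proof (rule theI)
    show "q \<in> positive_rvs \<and> (\<forall>t\<in>{0..<1}. pgf q t = phi \<N> t)" using q by simp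
    fix q' assume q': "q' \<in> positive_rvs \<and> (\<forall>t\<in>{0..<1}. pgf q' t = phi \<N> t)"
    show "q' = q" using q q' by (intro pgf_inject) simp
  qed
  then show "phi_law \<N> \<in> positive_rvs" "t \<in> {0..<1} \<Longrightarrow> pgf (phi_law \<N>) t = phi \<N> t" by auto
qed

lemma full_model_generator:
  assumes "\<N> \<in> full_models" "0 < t" "t < 1"
  shows "koenigs \<N> t = t * deriv (koenigs \<N>) t * (1 - pgf (phi_law \<N>) t)"
proof -
  interpret linearizer "koenigs \<N>" using assms(1) by (rule full_modelE)
  show ?thesis
    using phi_law_spec(2)[OF assms(1), of t] assms(2,3) by (intro generator_eqD) (simp_all add: phi_eq_generator)
qed

text \<open>The generator equation prescribes the logarithmic derivative, so
  \<open>ln K1 - ln K2\<close> is constant; the normalization of \<open>K t / t\<close> at 0 makes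
  the constant 0.\<close>

lemma linearizer_unique:
  assumes "linearizer K1" "linearizer K2"
    and gen: "\<And>t. 0 < t \<Longrightarrow> t < 1 \<Longrightarrow> K1 t = t * deriv K1 t * (1 - g t)"
      "\<And>t. 0 < t \<Longrightarrow> t < 1 \<Longrightarrow> K2 t = t * deriv K2 t * (1 - g t)"
    and t: "t \<in> {0..<1}"
  shows "K1 t = K2 t"
proof (cases "t = 0")
  case True
  then show ?thesis using assms(1,2) by (simp add: linearizer.K_0)
next
  case False
  interpret K1: linearizer K1 by fact
  interpret K2: linearizer K2 by fact
  define L where "L s = ln (K1 s) - ln (K2 s)" for s
  have ratio: "deriv K1 s / K1 s = deriv K2 s / K2 s" if s: "0 < s" "s < 1" for s
  proof -
    have "1 - g s \<noteq> 0" using gen(1)[OF s] K1.K_pos[OF s] by auto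
    have "deriv K1 s / (s * deriv K1 s * (1 - g s)) = deriv K2 s / (s * deriv K2 s * (1 - g s))"
      using K1.K_deriv_pos[OF s] K2.K_deriv_pos[OF s] by simp
    then show ?thesis by (simp only: gen(1)[OF s, symmetric] gen(2)[OF s, symmetric])
  qed
  have dL: "(L has_real_derivative 0) (at s within {0<..<1})" if "s \<in> {0<..<1}" for s
  proof -
    have "(L has_real_derivative deriv K1 s / K1 s - deriv K2 s / K2 s) (at s)"
      unfolding L_def using that by (intro DERIV_diff K1.ln_K_has_derivative K2.ln_K_has_derivative) auto
    then show ?thesis using ratio[of s] that by (simp add: has_field_derivative_at_within)
  qed
  obtain c where c: "\<And>s. s \<in> {0<..<1} \<Longrightarrow> L s = c"
    using has_field_derivative_zero_constant[of "{0<..<1}" L, OF _ dL] by auto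
  have ev: "\<forall>\<^sub>F s in at_right 0. s \<in> {0<..<1::real}"
    by (auto simp: eventually_at_right_field intro!: exI[of _ 1])
  have "((\<lambda>s. ln (K1 s / s) - ln (K2 s / s)) \<longlongrightarrow> ln 1 - ln 1) (at_right 0)"
    by (intro tendsto_intros K1.K_ratio K2.K_ratio) auto
  moreover have "\<forall>\<^sub>F s in at_right 0. ln (K1 s / s) - ln (K2 s / s) = c"
    using ev
  proof eventually_elim
    case (elim s)
    then show ?case using K1.K_pos[of s] K2.K_pos[of s] c[of s] by (simp add: ln_div L_def)
  qed
  ultimately have "((\<lambda>s::real. c) \<longlongrightarrow> 0) (at_right 0)"
    by (auto elim: Lim_transform_eventually)
  then have "c = 0" using tendsto_const_iff[of "at_right (0::real)" c 0] by simp
  then have "ln (K1 t) = ln (K2 t)" using c[of t] t False by (simp add: L_def)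
  then show ?thesis using K1.K_pos[of t] K2.K_pos[of t] t False by simp
qed

lemma inj_on_phi_law: "inj_on phi_law full_models"
proof -
  have sub: "\<N>1 \<subseteq> \<N>2"
    if full: "\<N>1 \<in> full_models" "\<N>2 \<in> full_models" and eq: "phi_law \<N>1 = phi_law \<N>2" for \<N>1 \<N>2
  proof
    interpret K1: linearizer "koenigs \<N>1" using full(1) by (rule full_modelE)
    interpret K2: linearizer "koenigs \<N>2" using full(2) by (rule full_modelE)
    have K_eq: "koenigs \<N>1 t = koenigs \<N>2 t" if "t \<in> {0..<1}" for t
      by (rule linearizer_unique[where g="pgf (phi_law \<N>1)"])
        (use that K1.linearizer_axioms K2.linearizer_axioms full_model_generator[OF full(1)]
          full_model_generator[OF full(2), folded eq] in auto)
    fix N assume N: "N \<in> \<N>1"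
    have "bij_betw (\<lambda>N. pmf N 1) \<N>1 {0<..1}" using full(1) by (simp add: full_models_def)
    then have \<theta>: "pmf N 1 \<in> {0<..1}" using N by (rule bij_betwE[THEN bspec])
    obtain M where M: "M \<in> \<N>2" "pmf M 1 = pmf N 1" using full_model_parameter[OF full(2) \<theta>] .
    have "pgf N t = pgf M t" if t: "0 < t" "t < 1" for t
    proof -
      let ?x = "K1.flow (pmf N 1) t"
      have x: "?x \<in> {0..<1}" "koenigs \<N>1 ?x = pmf N 1 * koenigs \<N>1 t"
        using K1.flow_in_unit[of "pmf N 1" t] K1.K_flow[of "pmf N 1" t] t by auto
      \<comment> \<open>The two Koenigs functions are known to agree on \<open>{0..<1}\<close> only,
        so the flows are compared through the equation that defines them rather than by rewriting
        one function into the other.\<close>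
      have "K2.flow (pmf M 1) t = ?x"
        using x K_eq[of ?x] K_eq[of t] t M(2) by (intro K2.flow_eqI) auto
      then show ?thesis
        using full_modelE(2)[OF full(1) N, of t] full_modelE(2)[OF full(2) M(1), of t] t by simp
    qed
    then have "N = M" by (rule pgf_inject)
    with M(1) show "N \<in> \<N>2" by simp
  qed
  show ?thesis by (intro inj_onI subset_antisym sub) simp_all
qed

text \<open>On the right half of the interval \<open>(ln K)' = 1 / (s * (1 - pgf q s))\<close> is at
  most \<open>2 / (1 - pgf q s)\<close>. If the latter were integrable up to 1, \<open>ln K\<close>
  would be bounded.\<close>

lemma (in linearizer) nonexplosive_generator:
  assumes q: "q \<in> positive_rvs" and gen: "\<And>t. 0 < t \<Longrightarrow> t < 1 \<Longrightarrow> K t = t * deriv K t * (1 - pgf q t)"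
  shows "nonexplosive q"
  unfolding nonexplosive_def
proof
  let ?f = "\<lambda>t. 1 / (1 - pgf q t)"
  assume int: "?f integrable_on {1/2..1}"
  have f_nonneg: "0 \<le> ?f t" if "t \<in> {1/2..1}" for t
    using pgf_le_1[of t q] that by simp
  define B where "B = ln (K (1/2)) + 2 * integral {1/2..1} ?f"
  have "ln (K t) \<le> B" if t: "1/2 < t" "t < 1" for t
  proof -
    have int': "?f integrable_on {1/2..t}"
      using t by (intro integrable_on_subinterval[OF int]) auto
    have "((\<lambda>s. deriv K s / K s) has_integral (ln (K t) - ln (K (1/2)))) {1/2..t}"
    proof (rule fundamental_theorem_of_calculus)
      show "((\<lambda>s. ln (K s)) has_vector_derivative deriv K s / K s) (at s within {1/2..t})" if "s \<in> {1/2..t}" for s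
        using ln_K_has_derivative[of s] that t
        by (simp add: has_real_derivative_iff_has_vector_derivative[symmetric] has_field_derivative_at_within)
    qed (use t in simp)
    moreover have "((\<lambda>s. 2 * ?f s) has_integral 2 * integral {1/2..t} ?f) {1/2..t}"
      by (intro has_integral_mult_right integrable_integral int')
    moreover have "deriv K s / K s \<le> 2 * ?f s" if s: "s \<in> {1/2..t}" for s
    proof -
      have s01: "0 < s" "s < 1" using s t by auto
      have p: "0 < 1 - pgf q s" using pgf_in_unit[OF q, of s] s01 by simp
      have "deriv K s / K s = 1 / (s * (1 - pgf q s))"
        using gen[OF s01] K_deriv_pos[OF s01] p s01 by simp
      also have "\<dots> = (1 / s) * ?f s" by simp
      also have "\<dots> \<le> 2 * ?f s" using s s01 p by (intro mult_right_mono) (auto simp: field_simps)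
      finally show ?thesis .
    qed
    ultimately have "ln (K t) - ln (K (1/2)) \<le> 2 * integral {1/2..t} ?f"
      by (rule has_integral_le)
    also have "\<dots> \<le> 2 * integral {1/2..1} ?f"
      using t int int' f_nonneg by (intro mult_left_mono integral_subset_le) auto
    finally show ?thesis by (simp add: B_def)
  qed
  moreover obtain t where "1/2 < t" "t < 1" "B < ln (K t)" using ln_K_unbounded by blast
  ultimately show False by force
qed

subsection \<open>The model of a semigroup\<close>

lemma pmf_iid_sum_pmf_0: "pmf (iid_sum_pmf M 0) i = (if i = 0 then 1 else 0)"
  by simp

lemma pmf_iid_sum_pmf_Suc:
  "pmf (iid_sum_pmf M (Suc n)) i = (\<Sum>j\<le>i. pmf M j * pmf (iid_sum_pmf M n) (i - j))"
proof -
  have "pmf (map_pmf ((+) x) (iid_sum_pmf M n)) i = (if x \<le> i then pmf (iid_sum_pmf M n) (i - x) else 0)" for x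
  proof (cases "x \<le> i")
    case True
    have "pmf (map_pmf ((+) x) (iid_sum_pmf M n)) (x + (i - x)) = pmf (iid_sum_pmf M n) (i - x)"
      by (rule pmf_map_inj') simp
    then show ?thesis using True by simp
  next
    case False
    then show ?thesis by (auto intro!: pmf_map_outside)
  qed
  then have "pmf (iid_sum_pmf M (Suc n)) i =
      measure_pmf.expectation M (\<lambda>x. if x \<le> i then pmf (iid_sum_pmf M n) (i - x) else 0)"
    by (simp add: pmf_bind)
  also have "\<dots> = (\<Sum>x\<le>i. (if x \<le> i then pmf (iid_sum_pmf M n) (i - x) else 0) * pmf M x)"
    by (intro integral_measure_pmf_real) (auto split: if_splits)
  finally show ?thesis by (simp add: mult.commute)
qed

lemma pmf_iid_sum_pmf_less:
  assumes "M \<in> positive_rvs"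
  shows "i < n \<Longrightarrow> pmf (iid_sum_pmf M n) i = 0"
proof (induction n arbitrary: i)
  case (Suc n)
  show ?case unfolding pmf_iid_sum_pmf_Suc
  proof (rule sum.neutral, rule ballI)
    fix j assume "j \<in> {..i}"
    then show "pmf M j * pmf (iid_sum_pmf M n) (i - j) = 0"
      using Suc assms by (cases j) (auto simp: positive_rvs_def)
  qed
qed simp

text \<open>Positive summands, \<open>n\<close> in number, add up to \<open>n\<close> only if each
  of them is 1.\<close>

lemma pmf_iid_sum_pmf_diag:
  assumes "M \<in> positive_rvs"
  shows "pmf (iid_sum_pmf M n) n = pmf M 1 ^ n"
proof (induction n)
  case (Suc n)
  have "pmf M j * pmf (iid_sum_pmf M n) (Suc n - j) = (if j = 1 then pmf M 1 ^ Suc n else 0)" if "j \<le> Suc n" for j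
  proof -
    consider "j = 0" | "j = 1" | "2 \<le> j" by linarith
    then show ?thesis
    proof cases
      case 3
      then show ?thesis using pmf_iid_sum_pmf_less[OF assms, of "Suc n - j" n] that by simp
    qed (use assms Suc in \<open>auto simp: positive_rvs_def\<close>)
  qed
  then show ?case unfolding pmf_iid_sum_pmf_Suc by simp
qed simp

text \<open>More than \<open>i\<close> positive summands exceed \<open>i\<close>, which makes the
  sum finite.\<close>

lemma pmf_comp_pmf:
  assumes "M \<in> positive_rvs"
  shows "pmf (comp_pmf N M) i = (\<Sum>n\<le>i. pmf N n * pmf (iid_sum_pmf M n) i)"
proof -
  have "pmf (comp_pmf N M) i = (\<Sum>n\<le>i. pmf (iid_sum_pmf M n) i * pmf N n)"
    unfolding comp_pmf_def pmf_bind
  proof (rule integral_measure_pmf_real)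
    fix n assume "pmf (iid_sum_pmf M n) i \<noteq> 0"
    then show "n \<in> {..i}" using pmf_iid_sum_pmf_less[OF assms, of i n] by force
  qed simp
  then show ?thesis by (simp add: mult.commute)
qed

section \<open>Polynomial dependence on the parameter\<close>

text \<open>A form of smoothness that is stable under the recursion for coefficients and needs no
  separate treatment of boundary points of \<open>S\<close>.\<close>

definition polynomial_on :: "real set \<Rightarrow> (real \<Rightarrow> real) \<Rightarrow> bool" where
  "polynomial_on S f \<longleftrightarrow> (\<exists>p. \<forall>x\<in>S. f x = poly p x)"

lemma polynomial_on_const: "polynomial_on S (\<lambda>_. c)"
  unfolding polynomial_on_def by (intro exI[of _ "[:c:]"]) simp

lemma polynomial_on_ident: "polynomial_on S (\<lambda>x. x)"
  unfolding polynomial_on_def by (intro exI[of _ "[:0, 1:]"]) simp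

lemma polynomial_on_mult: "polynomial_on S f \<Longrightarrow> polynomial_on S g \<Longrightarrow> polynomial_on S (\<lambda>x. f x * g x)"
  unfolding polynomial_on_def by (metis poly_mult)

lemma polynomial_on_diff: "polynomial_on S f \<Longrightarrow> polynomial_on S g \<Longrightarrow> polynomial_on S (\<lambda>x. f x - g x)"
  unfolding polynomial_on_def by (metis poly_diff)

lemma polynomial_on_sum:
  assumes "\<And>i. i \<in> A \<Longrightarrow> polynomial_on S (f i)"
  shows "polynomial_on S (\<lambda>x. \<Sum>i\<in>A. f i x)"
proof -
  obtain p where "\<And>i x. i \<in> A \<Longrightarrow> x \<in> S \<Longrightarrow> f i x = poly (p i) x"
    using assms unfolding polynomial_on_def by metis
  then show ?thesis
    unfolding polynomial_on_def by (intro exI[of _ "\<Sum>i\<in>A. p i"]) (simp add: poly_sum)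
qed

lemma polynomial_on_cong: "polynomial_on S f \<Longrightarrow> (\<And>x. x \<in> S \<Longrightarrow> f x = g x) \<Longrightarrow> polynomial_on S g"
  unfolding polynomial_on_def by auto

text \<open>Only coordinate 0 varies on \<open>S\<close>, so the Euclidean distance is
  \<open>\<bar>y 0 - x 0\<bar>\<close>. The quotient in \<open>C1_on\<close> then agrees up to sign
  with the one-variable difference quotient minus the derivative; hence the absolute values.\<close>

lemma C1_on_polynomial:
  assumes p: "\<And>x. x \<in> S \<Longrightarrow> f x = poly p (x 0)" and S: "\<And>x i. x \<in> S \<Longrightarrow> 1 \<le> i \<Longrightarrow> x i = 0"
  shows "C1_on 1 S f"
  unfolding C1_on_def
proof (intro exI[of _ "\<lambda>j x. poly (pderiv p) (x 0)"] conjI allI impI ballI)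
  show "continuous_on S (\<lambda>x. poly (pderiv p) (x 0))"
    by (intro continuous_intros continuous_on_subset[OF continuous_on_product_coordinates]) simp
next
  fix x assume x: "x \<in> S"
  let ?d = "poly (pderiv p) (x 0)"
  have "((\<lambda>z. (poly p z - poly p (x 0)) / (z - x 0)) \<longlongrightarrow> ?d) (at (x 0))"
    using poly_DERIV[of p "x 0"] by (simp add: has_field_derivative_iff)
  then have "((\<lambda>z. \<bar>(poly p z - poly p (x 0)) / (z - x 0) - ?d\<bar>) \<longlongrightarrow> \<bar>?d - ?d\<bar>) (at (x 0))"
    by (intro tendsto_intros)
  moreover have "filterlim (\<lambda>y. y 0) (at (x 0)) (at x within S)"
    unfolding filterlim_at
  proof
    have "y 0 \<noteq> x 0" if "y \<noteq> x" "y \<in> S" for y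
    proof
      assume "y 0 = x 0"
      then have "y i = x i" for i using S[OF x, of i] S[OF that(2), of i] by (cases i) auto
      then show False using that(1) by auto
    qed
    then show "\<forall>\<^sub>F y in at x within S. y 0 \<in> UNIV \<and> y 0 \<noteq> x 0"
      by (simp add: eventually_at_filter)
    show "((\<lambda>y. y 0) \<longlongrightarrow> x 0) (at x within S)"
      using continuous_on_product_coordinates[of 0] unfolding continuous_on_def
      by (blast intro: tendsto_within_subset)
  qed
  ultimately have "((\<lambda>y. \<bar>(poly p (y 0) - poly p (x 0)) / (y 0 - x 0) - ?d\<bar>) \<longlongrightarrow> 0) (at x within S)"
    using filterlim_compose by force
  moreover have "\<forall>\<^sub>F y in at x within S. \<bar>(poly p (y 0) - poly p (x 0)) / (y 0 - x 0) - ?d\<bar> =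
      \<bar>(f y - f x - (\<Sum>j<1. ?d * (y j - x j))) / L2_set (\<lambda>j. y j - x j) {..<1}\<bar>"
  proof -
    have "\<bar>(poly p (y 0) - poly p (x 0)) / (y 0 - x 0) - ?d\<bar> =
      \<bar>(f y - f x - (\<Sum>j<1. ?d * (y j - x j))) / L2_set (\<lambda>j. y j - x j) {..<1}\<bar>" if y: "y \<in> S" "y \<noteq> x" for y
    proof -
      have "y 0 - x 0 \<noteq> 0"
      proof
        assume "y 0 - x 0 = 0"
        then have "y i = x i" for i using S[OF x, of i] S[OF y(1), of i] by (cases i) auto
        then show False using y(2) by auto
      qed
      then have "(poly p (y 0) - poly p (x 0)) / (y 0 - x 0) - ?d =
          (poly p (y 0) - poly p (x 0) - ?d * (y 0 - x 0)) / (y 0 - x 0)"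
        by (simp add: diff_divide_distrib)
      moreover have "L2_set (\<lambda>j. y j - x j) {..<1} = \<bar>y 0 - x 0\<bar>"
        by (simp add: L2_set_def lessThan_Suc)
      ultimately show ?thesis
        using p x y by (simp add: abs_divide lessThan_Suc)
    qed
    then show ?thesis by (auto simp: eventually_at_filter)
  qed
  ultimately have "((\<lambda>y. \<bar>(f y - f x - (\<Sum>j<1. ?d * (y j - x j))) / L2_set (\<lambda>j. y j - x j) {..<1}\<bar>) \<longlongrightarrow> 0) (at x within S)"
    by (rule Lim_transform_eventually)
  then show "((\<lambda>y. (f y - f x - (\<Sum>j<1. ?d * (y j - x j))) / L2_set (\<lambda>j. y j - x j) {..<1}) \<longlongrightarrow> 0) (at x within S)"
    by (simp only: tendsto_rabs_zero_iff)
qed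

lemma polynomial_on_pmf_iid_sum:
  assumes "\<And>j. j < k \<Longrightarrow> polynomial_on S (\<lambda>\<theta>. pmf (M \<theta>) j)" and "m < k"
  shows "polynomial_on S (\<lambda>\<theta>. pmf (iid_sum_pmf (M \<theta>) n) m)"
  using assms(2)
proof (induction n arbitrary: m)
  case 0
  show ?case unfolding pmf_iid_sum_pmf_0 by (rule polynomial_on_const)
next
  case (Suc n)
  then show ?case
    unfolding pmf_iid_sum_pmf_Suc by (intro polynomial_on_sum polynomial_on_mult assms(1)) auto
qed

text \<open>With at least two positive summands adding up to \<open>k\<close>, each is smaller than
  \<open>k\<close>; the two extreme terms of the convolution vanish and only lower coefficients
  remain.\<close>

lemma polynomial_on_pmf_iid_sum':
  assumes "\<And>j. j < k \<Longrightarrow> polynomial_on S (\<lambda>\<theta>. pmf (M \<theta>) j)" and "2 \<le> n"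
    and pos: "\<And>\<theta>. \<theta> \<in> S \<Longrightarrow> M \<theta> \<in> positive_rvs"
  shows "polynomial_on S (\<lambda>\<theta>. pmf (iid_sum_pmf (M \<theta>) n) k)"
proof -
  obtain l where l: "n = Suc l" "0 < l" using assms(2) by (cases n) auto
  have "polynomial_on S (\<lambda>\<theta>. pmf (M \<theta>) j * pmf (iid_sum_pmf (M \<theta>) l) (k - j))" if j: "j \<le> k" for j
  proof -
    consider "j = 0" | "j = k" | "0 < j" "j < k" using j by linarith
    then show ?thesis
    proof cases
      case 1
      then show ?thesis
        using pos by (intro polynomial_on_cong[OF polynomial_on_const[of S 0]]) (simp add: positive_rvs_def)
    next
      case 2
      then show ?thesis
        using pmf_iid_sum_pmf_less[OF pos, of _ 0 l] l(2)
        by (intro polynomial_on_cong[OF polynomial_on_const[of S 0]]) simp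
    next
      case 3
      then show ?thesis
        by (intro polynomial_on_mult polynomial_on_pmf_iid_sum[where k=k] assms(1)) auto
    qed
  qed
  then show ?thesis unfolding l(1) pmf_iid_sum_pmf_Suc by (intro polynomial_on_sum) auto
qed

section \<open>The laws of a semigroup as a one-dimensional model\<close>

locale pgf_flow = linearizer +
  assumes flow_pgf: "0 < \<theta> \<Longrightarrow> \<theta> \<le> 1 \<Longrightarrow> is_pgf (flow \<theta>)"
begin

definition law :: "real \<Rightarrow> nat pmf" where
  "law \<theta> = (SOME M. M \<in> positive_rvs \<and> (\<forall>t\<in>{0..<1}. pgf M t = flow \<theta> t))"

lemma
  assumes "\<theta> \<in> {0<..1}"
  shows law_positive: "law \<theta> \<in> positive_rvs"
    and pgf_law: "t \<in> {0..<1} \<Longrightarrow> pgf (law \<theta>) t = flow \<theta> t"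
proof -
  obtain M where "M \<in> positive_rvs" "\<forall>t\<in>{0..<1}. flow \<theta> t = pgf M t"
    using flow_pgf[of \<theta>] assms unfolding is_pgf_def by auto
  then have "\<exists>M. M \<in> positive_rvs \<and> (\<forall>t\<in>{0..<1}. pgf M t = flow \<theta> t)" by auto
  from someI_ex[OF this] show "law \<theta> \<in> positive_rvs" "t \<in> {0..<1} \<Longrightarrow> pgf (law \<theta>) t = flow \<theta> t"
    by (auto simp: law_def)
qed

lemma pmf_law_1: "\<theta> \<in> {0<..1} \<Longrightarrow> pmf (law \<theta>) 1 = \<theta>"
  by (rule pmf_1_of_flow) (auto simp: law_positive pgf_law)

lemma comp_law:
  assumes "\<theta> \<in> {0<..1}" "\<eta> \<in> {0<..1}"
  shows "comp_pmf (law \<theta>) (law \<eta>) = law (\<theta> * \<eta>)"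
proof (rule pgf_inject)
  fix t :: real assume t: "0 < t" "t < 1"
  have "\<theta> * \<eta> \<in> {0<..1}" using assms by (auto simp: mult_le_one)
  moreover have "flow \<eta> t \<in> {0..<1}" using assms t by (intro flow_in_unit) auto
  ultimately show "pgf (comp_pmf (law \<theta>) (law \<eta>)) t = pgf (law (\<theta> * \<eta>)) t"
    using assms t flow_flow[of \<theta> \<eta> t] by (simp add: pgf_comp_pmf pgf_law)
qed

text \<open>Comparing coefficients in \<open>law \<theta> \<circ> law (1/2) = law (1/2) \<circ> law \<theta>\<close> gives a triangular system.\<close>

lemma polynomial_pmf_law: "polynomial_on {0<..1} (\<lambda>\<theta>. pmf (law \<theta>) k)"
proof (induction k rule: less_induct)
  case (less k)
  consider "k = 0" | "k = 1" | "2 \<le> k" by linarith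
  then show ?case
  proof cases
    case 1
    then show ?thesis
      using law_positive by (intro polynomial_on_cong[OF polynomial_on_const[of _ 0]]) (simp add: positive_rvs_def)
  next
    case 2
    then show ?thesis
      using pmf_law_1 by (intro polynomial_on_cong[OF polynomial_on_ident]) simp
  next
    case 3
    define A where "A = law (1/2)"
    have A: "A \<in> positive_rvs" "pmf A 1 = 1/2" unfolding A_def using law_positive[of "1/2"] pmf_law_1[of "1/2"] by simp_all
    \<comment> \<open>The factor of the unknown \<open>pmf (law \<theta>) k\<close>: the term
      \<open>n = k\<close> of one composition contributes \<open>(1/2) ^ k\<close>, the term
      \<open>n = 1\<close> of the other contributes 1/2. They differ because
      \<open>2 \<le> k\<close>.\<close>
    define b where "b = (1/2) ^ k - (1/2 :: real)"
    have "(1/2 :: real) ^ k \<le> (1/2) ^ 2" using 3 by (intro power_decreasing) auto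
    then have b: "b \<noteq> 0" by (simp add: b_def power2_eq_square)
    \<comment> \<open>\<open>L\<close> and \<open>R\<close> collect what remains on the two sides;
      both depend on \<theta> only through coefficients of index below \<open>k\<close>.\<close>
    define L where "L \<theta> = (\<Sum>n<k. pmf (law \<theta>) n * pmf (iid_sum_pmf A n) k)" for \<theta>
    define R where "R \<theta> = (\<Sum>n\<in>{2..k}. pmf A n * pmf (iid_sum_pmf (law \<theta>) n) k)" for \<theta>
    have eq: "(1 / b) * (R \<theta> - L \<theta>) = pmf (law \<theta>) k" if \<theta>: "\<theta> \<in> {0<..1}" for \<theta>
    proof -
      have "comp_pmf (law \<theta>) A = comp_pmf A (law \<theta>)"
        using \<theta> by (simp add: A_def comp_law mult.commute)
      then have "(\<Sum>n\<le>k. pmf (law \<theta>) n * pmf (iid_sum_pmf A n) k) = (\<Sum>n\<le>k. pmf A n * pmf (iid_sum_pmf (law \<theta>) n) k)"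
        using pmf_comp_pmf[OF A(1), of "law \<theta>" k] pmf_comp_pmf[OF law_positive[OF \<theta>], of A k] by simp
      moreover have "(\<Sum>n\<le>k. pmf (law \<theta>) n * pmf (iid_sum_pmf A n) k) = L \<theta> + pmf (law \<theta>) k * (1/2) ^ k"
      proof -
        have "pmf (iid_sum_pmf A k) k = (1/2) ^ k"
          using pmf_iid_sum_pmf_diag[OF A(1), of k] by (simp only: A(2))
        then show ?thesis by (simp add: L_def lessThan_Suc_atMost[symmetric])
      qed
      moreover have "(\<Sum>n\<le>k. pmf A n * pmf (iid_sum_pmf (law \<theta>) n) k) = (1/2) * pmf (law \<theta>) k + R \<theta>"
      proof -
        have "pmf (iid_sum_pmf (law \<theta>) 1) k = (\<Sum>j\<le>k. if j = k then pmf (law \<theta>) k else 0)"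
          unfolding One_nat_def pmf_iid_sum_pmf_Suc by (intro sum.cong) (auto simp: indicator_def)
        then have c1: "pmf (iid_sum_pmf (law \<theta>) 1) k = pmf (law \<theta>) k" by simp
        have "{..k} = insert 0 (insert 1 {2..k})" using 3 by auto
        then have "(\<Sum>n\<le>k. pmf A n * pmf (iid_sum_pmf (law \<theta>) n) k) =
            pmf A 0 * pmf (iid_sum_pmf (law \<theta>) 0) k + (pmf A 1 * pmf (iid_sum_pmf (law \<theta>) 1) k + R \<theta>)"
          by (simp add: R_def)
        then show ?thesis using A c1 by (simp add: positive_rvs_def)
      qed
      ultimately have "R \<theta> - L \<theta> = b * pmf (law \<theta>) k" by (simp add: b_def algebra_simps)
      then show ?thesis using b by simp
    qed
    have "polynomial_on {0<..1} L"
      unfolding L_def by (intro polynomial_on_sum polynomial_on_mult polynomial_on_const less.IH) auto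
    moreover have "polynomial_on {0<..1} R"
      unfolding R_def
      by (intro polynomial_on_sum polynomial_on_mult polynomial_on_const polynomial_on_pmf_iid_sum' less.IH)
        (auto simp: law_positive)
    ultimately have "polynomial_on {0<..1} (\<lambda>\<theta>. (1 / b) * (R \<theta> - L \<theta>))"
      by (intro polynomial_on_mult polynomial_on_const polynomial_on_diff)
    then show ?thesis using eq by (rule polynomial_on_cong)
  qed
qed

definition model :: "nat pmf set" where
  "model = law ` {0<..1}"

lemma model_positive: "model \<subseteq> positive_rvs"
  by (auto simp: model_def law_positive)

lemma bij_betw_law: "bij_betw law {0<..1} model"
  unfolding model_def
  by (intro bij_betw_imageI inj_on_inverseI[where g="\<lambda>N. pmf N 1"] pmf_law_1 refl)

lemma bij_betw_pmf_1_model: "bij_betw (\<lambda>N. pmf N 1) model {0<..1}"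
  by (rule bij_betw_byWitness[where f'=law]) (auto simp: model_def pmf_law_1[unfolded One_nat_def])

lemma closed_under_composition_model: "closed_under_composition model"
  unfolding closed_under_composition_def
proof (intro ballI)
  fix N1 N2 assume "N1 \<in> model" "N2 \<in> model"
  then obtain \<theta> \<eta> where *: "\<theta> \<in> {0<..1}" "\<eta> \<in> {0<..1}" "N1 = law \<theta>" "N2 = law \<eta>"
    unfolding model_def by blast
  have "\<theta> * \<eta> \<in> {0<..1}" using * by (auto simp: mult_le_one)
  then have "comp_pmf N1 N2 \<in> model" using comp_law[OF *(1,2)] *(3,4) by (simp add: model_def)
  then show "\<exists>N\<in>model. \<forall>t\<in>{0..1}. pgf N t = pgf N1 (pgf N2 t)"
    by (intro bexI[of _ "comp_pmf N1 N2"]) (simp_all add: pgf_comp_pmf)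
qed

lemma connected_model: "connected (pmf ` model)"
proof -
  have "continuous_on {0<..1} (\<lambda>\<theta>. pmf (law \<theta>))"
  proof (rule continuous_on_coordinatewise_then_product)
    fix i
    obtain p where "\<forall>\<theta>\<in>{0<..1}. pmf (law \<theta>) i = poly p \<theta>"
      using polynomial_pmf_law[of i] unfolding polynomial_on_def by blast
    then show "continuous_on {0<..1} (\<lambda>\<theta>. pmf (law \<theta>) i)"
      by (subst continuous_on_cong[OF refl, where g="poly p"]) (auto intro!: continuous_intros)
  qed
  moreover have "connected {0<..1::real}" by (intro convex_connected convex_real_interval)
  ultimately have "connected ((\<lambda>\<theta>. pmf (law \<theta>)) ` {0<..1})" by (rule connected_continuous_image)
  then show ?thesis by (simp add: model_def image_image)
qed

definition parameters :: "(nat \<Rightarrow> real) set" where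
  "parameters = {x. (\<forall>i\<ge>1. x i = 0) \<and> x 0 \<in> {0<..1}}"

lemma openin_interior_parameters:
  "openin (Euclidean_space 1) {x. (\<forall>i\<ge>1. x i = 0) \<and> x 0 \<in> {0<..<1}}"
  unfolding Euclidean_space_def openin_subtopology
proof (intro exI conjI)
  have "open {x :: nat \<Rightarrow> real. 0 < x 0 \<and> x 0 < 1}"
    by (intro open_Collect_conj open_Collect_less continuous_on_const continuous_on_product_coordinates)
  then show "openin (powertop_real UNIV) {x :: nat \<Rightarrow> real. 0 < x 0 \<and> x 0 < 1}"
    by (simp add: euclidean_product_topology)
qed auto

lemma open_with_boundary_parameters: "open_with_boundary 1 parameters"
  unfolding open_with_boundary_def
proof (intro exI conjI)
  let ?U = "{x :: nat \<Rightarrow> real. (\<forall>i\<ge>1. x i = 0) \<and> x 0 \<in> {0<..<1}}"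
  show "openin (Euclidean_space 1) ?U" by (rule openin_interior_parameters)
  show "?U \<subseteq> parameters" by (auto simp: parameters_def)
  show "parameters \<subseteq> Euclidean_space 1 closure_of ?U"
  proof
    fix x assume x: "x \<in> parameters"
    have "\<exists>y\<in>?U. y \<in> T" if T: "x \<in> T" "openin (Euclidean_space 1) T" for T
    proof -
      obtain e where e: "0 < e" "\<forall>s. \<bar>s\<bar> < e \<longrightarrow> x(0 := x 0 + s) \<in> T"
        using openin_Euclidean_space_perturb[OF T(2,1)] by auto
      \<comment> \<open>A downward move by less than \<open>e\<close> and by at most half of
        \<open>x 0\<close>: it leaves 1 if \<open>x 0 = 1\<close>, and it stays above 0.\<close>
      define s where "s = - min (e / 2) (x 0 / 2)"
      have "0 < x 0" "x 0 \<le> 1" using x by (auto simp: parameters_def)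
      then have "\<bar>s\<bar> < e" "0 < x 0 + s" "x 0 + s < 1" using e(1) by (auto simp: s_def)
      moreover then have "x(0 := x 0 + s) \<in> T" using e(2) by blast
      ultimately show ?thesis
        using x by (intro bexI[of _ "x(0 := x 0 + s)"]) (auto simp: parameters_def)
    qed
    then show "x \<in> Euclidean_space 1 closure_of ?U"
      using x by (auto simp: in_closure_of topspace_Euclidean_space parameters_def)
  qed
qed

lemma regular_model: "regular_stopping_model model"
  unfolding regular_stopping_model_def
proof (intro conjI exI)
  let ?P = "\<lambda>x :: nat \<Rightarrow> real. law (x 0)"
  let ?A = "{(parameters, ?P)}"
  have bij: "bij_betw ?P parameters model"
  proof -
    have "bij_betw (\<lambda>x. x 0) parameters {0<..1}"
      by (rule bij_betw_byWitness[where f'="\<lambda>\<theta> i. if i = 0 then \<theta> else 0"])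
        (auto simp: parameters_def fun_eq_iff)
    then show ?thesis using bij_betw_trans[OF _ bij_betw_law] by (simp add: o_def)
  qed
  show "finite_dim_structure 1 ?A model"
    unfolding finite_dim_structure_def global_parametrization_def
    using bij open_with_boundary_parameters by blast
  have "{x. (\<forall>i\<ge>1. x i = 0) \<and> x 0 \<in> {0<..<1}} \<subseteq> Euclidean_space 1 interior_of parameters"
    by (intro interior_of_maximal openin_interior_parameters) (auto simp: parameters_def)
  then have "(\<lambda>i. if i = 0 then 1/2 else 0) \<in> Euclidean_space 1 interior_of parameters"
    by (rule subsetD) simp
  then show "structure_interior 1 ?A \<noteq> {}"
    unfolding structure_interior_def by blast
  have "C1_on 1 parameters (\<lambda>x. pmf (?P x) i)" for i
  proof -
    obtain p where "\<forall>\<theta>\<in>{0<..1}. pmf (law \<theta>) i = poly p \<theta>"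
      using polynomial_pmf_law[of i] unfolding polynomial_on_def by blast
    then show ?thesis by (intro C1_on_polynomial[of _ _ p]) (auto simp: parameters_def)
  qed
  then show "C1_probabilities 1 ?A" by (simp add: C1_probabilities_def)
qed (fact model_positive closed_under_composition_model connected_model)+

lemma full_model: "model \<in> full_models"
  using regular_model bij_betw_pmf_1_model by (simp add: full_models_def)

text \<open>Whichever member is selected, its iterates are \<open>flow (\<theta> ^ n) t\<close>, on
  which \<open>K\<close> equals \<open>\<theta> ^ n * K t\<close>. They tend to 0, where
  \<open>K x / x\<close> tends to 1, so dividing by \<open>\<theta> ^ n\<close> leaves
  \<open>K t\<close> in the limit.\<close>

lemma koenigs_model:
  assumes t: "t \<in> {0..<1}"
  shows "koenigs model t = K t"
proof -
  obtain N where N: "N \<in> model" "N \<noteq> N_I" and k: "koenigs model = koenigs_pgf N"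
    using koenigs_eq[OF regular_stopping_model_nontrivial[OF regular_model]] .
  obtain \<theta> where \<theta>: "\<theta> \<in> {0<..1}" "N = law \<theta>" using N(1) by (auto simp: model_def)
  have p1: "pmf N 1 = \<theta>" using \<theta> pmf_law_1 by simp
  interpret N: proper_pgf N
    using N model_positive \<theta>(1) p1 by (intro proper_pgfI) auto
  show ?thesis
  proof (cases "t = 0")
    case True
    then show ?thesis by (simp add: k N.K_0 K_0)
  next
    case False
    then have t0: "0 < t" using t by simp
    have it: "(pgf N ^^ n) t = flow (\<theta> ^ n) t" for n
    proof (induction n)
      case 0
      then show ?case using t by (simp add: flow_1)
    next
      case (Suc n)
      have "flow (\<theta> ^ n) t \<in> {0..<1}" using \<theta>(1) t by (intro flow_in_unit) auto
      then show ?case using Suc \<theta> t flow_flow[of \<theta> "\<theta> ^ n" t] by (simp add: pgf_law)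
    qed
    have pos: "0 < flow (\<theta> ^ n) t" for n using \<theta>(1) t t0 by (intro flow_pos) auto
    have "(\<lambda>n. K (flow (\<theta> ^ n) t) / flow (\<theta> ^ n) t) \<longlonglongrightarrow> 1"
      using N.iterate_tendsto_0[OF t] pos by (intro K_ratio_0) (simp_all add: it)
    then have "(\<lambda>n. K t / (K (flow (\<theta> ^ n) t) / flow (\<theta> ^ n) t)) \<longlonglongrightarrow> K t / 1"
      by (intro tendsto_intros) auto
    moreover have "K t / (K (flow (\<theta> ^ n) t) / flow (\<theta> ^ n) t) = (pgf N ^^ n) t / pmf N 1 ^ n" for n
      using K_flow[of "\<theta> ^ n" t] K_pos[OF t0] \<theta>(1) t unfolding it p1 by simp
    ultimately have "(\<lambda>n. (pgf N ^^ n) t / pmf N 1 ^ n) \<longlonglongrightarrow> K t" by simp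
    then show ?thesis unfolding k using N.koenigs_pgf_LIMSEQ[OF t] LIMSEQ_unique by blast
  qed
qed

lemma phi_law_model:
  assumes q: "q \<in> positive_rvs" and gen: "\<And>t. 0 < t \<Longrightarrow> t < 1 \<Longrightarrow> K t = t * deriv K t * (1 - pgf q t)"
  shows "phi_law model = q"
proof (rule pgf_inject)
  fix t :: real assume t: "0 < t" "t < 1"
  \<comment> \<open>Derivatives at \<open>t\<close> require agreement on a neighbourhood; an
    interior point has one inside the unit interval.\<close>
  have "\<forall>\<^sub>F s in nhds t. koenigs model s = K s"
    using t by (intro eventually_nhds_in_open[of "{0<..<1}", THEN eventually_mono]) (auto simp: koenigs_model)
  then have "deriv (koenigs model) t = deriv K t" by (intro deriv_cong_ev) auto
  then have "phi model t = 1 - K t / (t * deriv K t)"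
    using t by (simp add: phi_eq_generator koenigs_model)
  also have "\<dots> = pgf q t" using gen[OF t] K_deriv_pos[OF t] t by (simp add: field_simps)
  finally show "pgf (phi_law model) t = pgf q t"
    using phi_law_spec(2)[OF full_model, of t] t by simp
qed

end

subsection \<open>Nonexplosive laws\<close>

locale nonexplosive_law =
  fixes q :: "nat pmf"
  assumes q: "q \<in> positive_rvs" and nonexplosive: "nonexplosive q"
begin

text \<open>The derivative of \<open>ln (K t / t)\<close> prescribed by the generator equation:
  \<open>1 / (t * (1 - pgf q t)) - 1 / t = (pgf q t / t) / (1 - pgf q t)\<close>. Writing
  \<open>pgf q t / t\<close> as the pgf of the shifted law removes the singularity at 0, so the
  integral in \<open>K\<close> can start there.\<close>

definition growth :: "real \<Rightarrow> real" where
  "growth s = pgf (map_pmf (\<lambda>n. n - 1) q) s / (1 - pgf q s)"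

definition K :: "real \<Rightarrow> real" where
  "K t = t * exp (integral {0..t} growth)"

lemma pgf_q_eq:
  assumes "\<bar>t\<bar> \<le> 1"
  shows "pgf q t = t * pgf (map_pmf (\<lambda>n. n - 1) q) t"
proof -
  have "map_pmf Suc (map_pmf (\<lambda>n. n - 1) q) = map_pmf (\<lambda>n. n) q"
    unfolding pmf.map_comp o_def
  proof (rule map_pmf_cong[OF refl])
    fix n assume "n \<in> set_pmf q"
    then show "Suc (n - 1) = n" using q by (cases n) (auto simp: positive_rvs_def set_pmf_iff)
  qed
  then have "pgf q t = pgf (map_pmf Suc (map_pmf (\<lambda>n. n - 1) q)) t" by (simp add: pmf.map_ident)
  also have "\<dots> = t * pgf (map_pmf (\<lambda>n. n - 1) q) t" using assms by (simp add: pgf_eq_expectation)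
  finally show ?thesis .
qed

lemma one_minus_pgf_pos: "0 \<le> t \<Longrightarrow> t < 1 \<Longrightarrow> 0 < 1 - pgf q t"
  using pgf_in_unit[OF q, of t] by simp

lemma growth_continuous: "continuous_on {0..<1} growth"
  unfolding growth_def
proof (intro continuous_on_divide continuous_on_diff continuous_on_const)
  show "continuous_on {0..<1} (pgf (map_pmf (\<lambda>n. n - 1) q))" "continuous_on {0..<1} (pgf q)"
    by (rule continuous_on_subset[OF continuous_on_pgf]; force)+
  show "\<forall>s\<in>{0..<1}. 1 - pgf q s \<noteq> 0" using one_minus_pgf_pos by force
qed

lemma growth_integrable: "0 \<le> a \<Longrightarrow> b < 1 \<Longrightarrow> growth integrable_on {a..b}"
  by (intro integrable_continuous_real continuous_on_subset[OF growth_continuous]) auto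

lemma growth_nonneg: "0 \<le> t \<Longrightarrow> t < 1 \<Longrightarrow> 0 \<le> growth t"
  using one_minus_pgf_pos[of t] pgf_nonneg[of t "map_pmf (\<lambda>n. n - 1) q"] by (simp add: growth_def)

lemma one_plus_growth:
  assumes "0 \<le> t" "t < 1"
  shows "1 + t * growth t = 1 / (1 - pgf q t)"
  using pgf_q_eq[of t] one_minus_pgf_pos[OF assms] assms by (simp add: growth_def field_simps)

lemma K_has_derivative:
  assumes t: "0 < t" "t < 1"
  shows "(K has_real_derivative exp (integral {0..t} growth) / (1 - pgf q t)) (at t)"
proof -
  obtain b where b: "t < b" "b < 1" using t dense by blast
  have "((\<lambda>u. integral {0..u} growth) has_real_derivative growth t) (at t within {0..b})"
    using t b by (intro integral_has_real_derivative continuous_on_subset[OF growth_continuous]) auto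
  moreover have "at t within {0..b} = at t"
    using t b by (intro at_within_interior) simp
  ultimately have "((\<lambda>u. integral {0..u} growth) has_real_derivative growth t) (at t)" by simp
  then have "(K has_real_derivative 1 * exp (integral {0..t} growth) + exp (integral {0..t} growth) * growth t * t) (at t)"
    unfolding K_def[abs_def] by (intro DERIV_mult DERIV_ident DERIV_fun_exp)
  moreover have "1 * exp (integral {0..t} growth) + exp (integral {0..t} growth) * growth t * t =
      exp (integral {0..t} growth) * (1 + t * growth t)" by (simp add: algebra_simps)
  ultimately show ?thesis using one_plus_growth[of t] t by simp
qed

lemma K_eq:
  assumes "0 < t" "t < 1"
  shows "K t = t * deriv K t * (1 - pgf q t)"
  using DERIV_imp_deriv[OF K_has_derivative[OF assms]] one_minus_pgf_pos[of t] assms by (simp add: K_def)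

text \<open>Since \<open>1 / (1 - pgf q t) = 1 + t * growth t \<le> 1 + growth t\<close>, a bound on
  the integrals of \<open>growth\<close> bounds those of \<open>1 / (1 - pgf q)\<close> over
  intervals exhausting \<open>{1/2..<1}\<close>. Monotone convergence would then give integrability
  up to 1.\<close>

lemma integral_growth_unbounded: "\<exists>t\<in>{1/2..<1}. B < integral {0..t} growth"
proof (rule ccontr)
  assume "\<not> ?thesis"
  then have le: "integral {0..t} growth \<le> B" if "t \<in> {1/2..<1}" for t using that by force
  define f where "f t = 1 / (1 - pgf q t)" for t
  define c where "c n = 1 - 1 / real (n + 2)" for n
  have c: "1/2 \<le> c n" "c n < 1" for n by (auto simp: c_def field_simps)
  have f_le: "f t \<le> 1 + growth t" if "0 \<le> t" "t < 1" for t
    using one_plus_growth[OF that] growth_nonneg[OF that] that mult_left_le_one_le[of "growth t" t]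
    by (simp add: f_def)
  have f_nonneg: "0 \<le> f t" if "t \<in> {1/2..1}" for t
    using pgf_le_1[of t q] that by (simp add: f_def)
  have f_int: "f integrable_on {1/2..c n}" for n
    unfolding f_def
  proof (intro integrable_continuous_real continuous_intros)
    show "continuous_on {1/2..c n} (pgf q)"
      using c[of n] by (intro continuous_on_subset[OF continuous_on_pgf]) auto
    show "\<forall>s\<in>{1/2..c n}. 1 - pgf q s \<noteq> 0"
    proof
      fix s assume "s \<in> {1/2..c n}"
      then show "1 - pgf q s \<noteq> 0" using one_minus_pgf_pos[of s] c[of n] by simp
    qed
  qed
  define F where "F n t = (if t \<in> {1/2..c n} then f t else 0)" for n t
  have sub: "{1/2..c n} \<inter> {1/2..1} = {1/2..c n}" for n using c[of n] by auto
  have F_int: "F n integrable_on {1/2..1}" for n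
    unfolding F_def integrable_restrict_Int sub by (rule f_int)
  have F_val: "integral {1/2..1} (F n) = integral {1/2..c n} f" for n
    unfolding F_def integral_restrict_Int sub by (rule refl)
  have F_bound: "integral {1/2..1} (F n) \<le> 1 + B" for n
  proof -
    have g_int: "growth integrable_on {1/2..c n}" using c[of n] by (intro growth_integrable) auto
    have "integral {1/2..c n} f \<le> integral {1/2..c n} (\<lambda>t. 1 + growth t)"
      using c[of n] f_int g_int by (intro integral_le integrable_add f_le) auto
    also have "\<dots> = (c n - 1/2) + integral {1/2..c n} growth"
      using c[of n] g_int by (subst integral_add) auto
    also have "integral {1/2..c n} growth \<le> integral {0..c n} growth"
      using c[of n] g_int growth_integrable[of 0 "c n"] growth_nonneg by (intro integral_subset_le) auto
    also have "integral {0..c n} growth \<le> B" using c[of n] by (intro le) auto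
    finally show ?thesis using c[of n] by (simp add: F_val)
  qed
  have F_nonneg: "0 \<le> integral {1/2..1} (F n)" for n
    unfolding F_val using c[of n] by (intro integral_nonneg f_int f_nonneg) auto
  have "f integrable_on {1/2..1} \<and> (\<lambda>n. integral {1/2..1} (F n)) \<longlonglongrightarrow> integral {1/2..1} f"
  proof (rule monotone_convergence_increasing)
    show "F n integrable_on {1/2..1}" for n by (rule F_int)
    show "F n t \<le> F (Suc n) t" if "t \<in> {1/2..1}" for n t
    proof -
      have "c n \<le> c (Suc n)" by (simp add: c_def frac_le)
      then show ?thesis using f_nonneg[OF that] by (auto simp: F_def)
    qed
    show "(\<lambda>n. F n t) \<longlonglongrightarrow> f t" if t: "t \<in> {1/2..1}" for t
    proof (cases "t = 1")
      case True
      \<comment> \<open>At 1 the denominator of \<open>f\<close> vanishes, and division by zero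
        gives the value 0, matching the truncations.\<close>
      then have "F n t = 0" "f t = 0" for n using c[of n] by (auto simp: F_def f_def)
      then show ?thesis by simp
    next
      case False
      have "c \<longlonglongrightarrow> 1 - 0"
        unfolding c_def by (intro tendsto_intros LIMSEQ_ignore_initial_segment[OF lim_const_over_n])
      then have "\<forall>\<^sub>F n in sequentially. t < c n"
        using t False by (intro order_tendstoD) auto
      then have "\<forall>\<^sub>F n in sequentially. F n t = f t"
        by eventually_elim (use t in \<open>auto simp: F_def\<close>)
      then show ?thesis by (rule tendsto_eventually)
    qed
    show "bounded (range (\<lambda>n. integral {1/2..1} (F n)))"
      unfolding bounded_iff using F_bound F_nonneg by (intro exI[of _ "1 + B"]) auto
  qed
  then show False using nonexplosive by (simp add: nonexplosive_def f_def[abs_def])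
qed

sublocale linearizer K
proof
  show "K 0 = 0" by (simp add: K_def)
  have "continuous_on {0..1/2} (\<lambda>t. integral {0..t} growth)"
    by (intro indefinite_integral_continuous_1 growth_integrable) auto
  then have "((\<lambda>t. integral {0..t} growth) \<longlongrightarrow> integral {0..0} growth) (at_right 0)"
    by (rule continuous_on_Icc_at_rightD) simp
  then have "((\<lambda>t. exp (integral {0..t} growth)) \<longlongrightarrow> exp 0) (at_right 0)"
    by (intro tendsto_intros) simp
  moreover have "\<forall>\<^sub>F t in at_right 0. exp (integral {0..t} growth) = K t / t"
    by (auto simp: eventually_at_right_field K_def intro!: exI[of _ 1])
  ultimately show "((\<lambda>t. K t / t) \<longlongrightarrow> 1) (at_right 0)"
    by (auto elim: Lim_transform_eventually)
next
  fix t :: real assume t: "0 < t" "t < 1"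
  show "K differentiable at t"
    using K_has_derivative[OF t] unfolding real_differentiable_def by blast
  show "0 < deriv K t"
    using DERIV_imp_deriv[OF K_has_derivative[OF t]] one_minus_pgf_pos[of t] t by simp
next
  fix B
  \<comment> \<open>The factor 2 compensates for \<open>t \<ge> 1/2\<close> in \<open>K t\<close>,
    and the maximum with 1 keeps the argument of the logarithm positive.\<close>
  obtain t where t: "t \<in> {1/2..<1}" "ln (2 * max 1 B) < integral {0..t} growth"
    using integral_growth_unbounded by blast
  then have "2 * max 1 B < exp (integral {0..t} growth)"
    using ln_less_cancel_iff[of "2 * max 1 B" "exp (integral {0..t} growth)"] by simp
  then have "1/2 * (2 * max 1 B) < t * exp (integral {0..t} growth)"
    using t by (intro mult_le_less_imp_less) auto
  then have "B < K t" by (simp add: K_def)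
  then show "\<exists>t\<in>{0..<1}. B < K t" using t(1) by (intro bexI[of _ t]) auto
qed

sublocale pgf_flow K
  by unfold_locales (rule flow_is_pgf[OF q K_eq])

lemma phi_law_surj: "\<exists>\<N>\<in>full_models. phi_law \<N> = q"
  using full_model phi_law_model[OF q K_eq] by blast

end

theorem bij_betw_phi_law: "bij_betw phi_law full_models {q \<in> positive_rvs. nonexplosive q}"
  unfolding bij_betw_def
proof (intro conjI subset_antisym subsetI)
  show "inj_on phi_law full_models" by (rule inj_on_phi_law)
next
  fix q assume "q \<in> phi_law ` full_models"
  then obtain \<N> where \<N>: "\<N> \<in> full_models" "q = phi_law \<N>" by blast
  interpret linearizer "koenigs \<N>" using \<N>(1) by (rule full_modelE)
  have "q \<in> positive_rvs" using phi_law_spec(1) \<N> by simp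
  moreover from this have "nonexplosive q"
    using full_model_generator[OF \<N>(1)] unfolding \<N>(2) by (rule nonexplosive_generator)
  ultimately show "q \<in> {q \<in> positive_rvs. nonexplosive q}" by simp
next
  fix q assume "q \<in> {q \<in> positive_rvs. nonexplosive q}"
  then interpret nonexplosive_law q by unfold_locales auto
  show "q \<in> phi_law ` full_models" using phi_law_surj by blast
qed

section \<open>Finite mean, tilting and the bijection with all positive laws\<close>

text \<open>From \<open>1 - t ^ i \<le> i * (1 - t)\<close> the mean \<open>m\<close> gives
  \<open>1 - pgf q t \<le> m * (1 - t)\<close>, so \<open>1 / (1 - pgf q t)\<close> is at least
  \<open>1 / (m * (1 - t))\<close>, whose integral diverges logarithmically at 1.\<close>

lemma nonexplosive_of_finite_mean:
  assumes q: "q \<in> positive_rvs" and mean: "summable (\<lambda>i. real i * pmf q i)"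
  shows "nonexplosive q"
proof -
  define m where "m = (\<Sum>i. real i * pmf q i)"
  have le: "1 - pgf q t \<le> m * (1 - t)" if t: "0 \<le> t" "t < 1" for t
  proof -
    have "(\<Sum>i. pmf q i * (1 - t ^ i)) \<le> (\<Sum>i. real i * pmf q i * (1 - t))"
    proof (intro suminf_le summable_mult2 mean)
      fix i
      have "1 - t ^ i = (1 - t) * (\<Sum>k<i. t ^ k)" by (rule one_diff_power_eq)
      also have "\<dots> \<le> (1 - t) * (\<Sum>k<i. 1)"
        using t by (intro mult_left_mono sum_mono power_le_one) auto
      finally have "1 - t ^ i \<le> real i * (1 - t)" by (simp add: mult.commute)
      then show "pmf q i * (1 - t ^ i) \<le> real i * pmf q i * (1 - t)"
        using mult_left_mono[of _ _ "pmf q i"] by (fastforce simp: mult_ac)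
      show "summable (\<lambda>i. pmf q i * (1 - t ^ i))"
        using summable_diff[OF summable_pmf_nat[of q] summable_pgf[of t q]] t by (simp add: right_diff_distrib)
    qed
    moreover have "(\<Sum>i. pmf q i * (1 - t ^ i)) = 1 - pgf q t"
      using suminf_diff[OF summable_pmf_nat[of q] summable_pgf[of t q]] t
      by (simp add: suminf_pmf_nat pgf_def right_diff_distrib)
    moreover have "(\<Sum>i. real i * pmf q i * (1 - t)) = m * (1 - t)"
      unfolding m_def by (rule suminf_mult2[symmetric, OF mean])
    ultimately show ?thesis by simp
  qed
  have "0 < 1 - pgf q 0" using pgf_in_unit[OF q, of 0] by simp
  with le[of 0] have m: "0 < m" by simp
  show ?thesis
    unfolding nonexplosive_def
  proof
    let ?f = "\<lambda>t. 1 / (1 - pgf q t)"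
    assume int: "?f integrable_on {1/2..1}"
    define B where "B = m * integral {1/2..1} ?f"
    have bound: "ln (1/2) - ln (1 - t) \<le> B" if t: "1/2 < t" "t < 1" for t
    proof -
      have int': "?f integrable_on {1/2..t}"
        using t by (intro integrable_on_subinterval[OF int]) auto
      have "((\<lambda>s. 1 / (1 - s)) has_integral (- ln (1 - t) - (- ln (1 - 1/2)))) {1/2..t}"
      proof (rule fundamental_theorem_of_calculus)
        fix s assume "s \<in> {1/2..t}"
        then have "((\<lambda>s. - ln (1 - s)) has_real_derivative 1 / (1 - s)) (at s)"
          using t by (auto intro!: derivative_eq_intros)
        then show "((\<lambda>s. - ln (1 - s)) has_vector_derivative 1 / (1 - s)) (at s within {1/2..t})"
          by (simp add: has_real_derivative_iff_has_vector_derivative[symmetric] has_field_derivative_at_within)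
      qed (use t in simp)
      moreover have "((\<lambda>s. m * ?f s) has_integral m * integral {1/2..t} ?f) {1/2..t}"
        by (intro has_integral_mult_right integrable_integral int')
      moreover have "1 / (1 - s) \<le> m * ?f s" if "s \<in> {1/2..t}" for s
        using le[of s] pgf_in_unit[OF q, of s] that t by (simp add: field_simps)
      ultimately have "- ln (1 - t) - (- ln (1 - 1/2)) \<le> m * integral {1/2..t} ?f"
        by (rule has_integral_le)
      also have "\<dots> \<le> B"
        unfolding B_def using t int int' m pgf_le_1[of _ q]
        by (intro mult_left_mono integral_subset_le) auto
      finally show ?thesis by simp
    qed
    \<comment> \<open>At the point \<open>1 - e\<close>, which lies beyond 1/2, the logarithm
      exceeds the bound \<open>B\<close> by at least 1.\<close>
    define e where "e = min (1/4) (exp (ln (1/2) - B - 1))"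
    have e: "0 < e" "e \<le> 1/4" "e \<le> exp (ln (1/2) - B - 1)" by (auto simp: e_def)
    have "ln e \<le> ln (1/2) - B - 1"
      using e ln_le_cancel_iff[of e "exp (ln (1/2) - B - 1)"] by simp
    moreover have "ln (1/2) - ln e \<le> B" using bound[of "1 - e"] e by simp
    ultimately show False by simp
  qed
qed

text \<open>Exponential tilting embeds all laws into those with finite mean.\<close>

lemma tilting:
  assumes "q \<in> positive_rvs"
  shows "\<exists>r. r \<in> positive_rvs \<and> nonexplosive r \<and> (\<forall>i. pmf r i = pmf q i * (1/2) ^ i / pgf q (1/2))"
proof -
  have Z: "0 < pgf q (1/2)" by (rule pgf_pos) auto
  define c where "c i = pmf q i * (1/2) ^ i / pgf q (1/2)" for i
  have "c sums (pgf q (1/2) / pgf q (1/2))"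
    unfolding c_def by (intro sums_divide pgf_sums) simp
  moreover have "0 \<le> c i" for i using Z by (simp add: c_def)
  ultimately obtain r where r: "pmf r = c" using pmf_of_coefficients[of c] Z by auto
  have pos: "r \<in> positive_rvs" using assms by (simp add: positive_rvs_def r c_def)
  \<comment> \<open>The geometric weight absorbs the factor \<open>i\<close>, whatever the tail of
    \<open>q\<close>; the normalizing constant is positive.\<close>
  have "summable (\<lambda>i. real i * pmf r i)"
  proof (rule summable_comparison_test')
    show "summable (\<lambda>i. real (Suc i) * (1/2) ^ i / pgf q (1/2))"
      using geometric_deriv_sums[of "1/2 :: real"] by (intro summable_divide) (simp add: sums_iff)
    fix i
    have "real i * (pmf q i * (1/2) ^ i) \<le> real (Suc i) * (1 * (1/2) ^ i)"
      using pmf_le_1[of q i] by (intro mult_mono) auto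
    then have "real i * (pmf q i * (1/2) ^ i) / pgf q (1/2) \<le> real (Suc i) * (1/2) ^ i / pgf q (1/2)"
      using Z by (intro divide_right_mono) auto
    then show "norm (real i * pmf r i) \<le> real (Suc i) * (1/2) ^ i / pgf q (1/2)"
      using Z by (simp add: r c_def)
  qed
  then have "nonexplosive r" using pos by (intro nonexplosive_of_finite_mean)
  with pos show ?thesis by (intro exI[of _ r]) (simp add: r c_def)
qed

text \<open>Schroeder-Bernstein with the inclusion in one direction and tilting in the other.
  Tilting is injective because laws with the same tilt are proportional and both have total mass
  1.\<close>

lemma ex_bij_nonexplosive: "\<exists>f. bij_betw f {q \<in> positive_rvs. nonexplosive q} positive_rvs"
proof -
  obtain tilt where tilt: "\<And>q. q \<in> positive_rvs \<Longrightarrow> tilt q \<in> positive_rvs \<and> nonexplosive (tilt q) \<and>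
      (\<forall>i. pmf (tilt q) i = pmf q i * (1/2) ^ i / pgf q (1/2))"
    using tilting by metis
  have "inj_on tilt positive_rvs"
  proof (rule inj_onI)
    fix q r assume qr: "q \<in> positive_rvs" "r \<in> positive_rvs" and eq: "tilt q = tilt r"
    define a where "a = pgf q (1/2) / pgf r (1/2)"
    have Z: "0 < pgf q (1/2)" "0 < pgf r (1/2)" by (auto intro: pgf_pos)
    have pq: "pmf q i = a * pmf r i" for i
    proof -
      have "pmf q i * (1/2) ^ i / pgf q (1/2) = pmf r i * (1/2) ^ i / pgf r (1/2)"
        using tilt[OF qr(1)] tilt[OF qr(2)] eq by metis
      then show ?thesis using Z by (simp add: a_def field_simps)
    qed
    have "(\<Sum>i. pmf q i) = a * (\<Sum>i. pmf r i)"
      unfolding pq by (rule suminf_mult[OF summable_pmf_nat])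
    then have "a = 1" by (simp add: suminf_pmf_nat)
    with pq show "q = r" by (intro pmf_eqI) simp
  qed
  moreover have "tilt ` positive_rvs \<subseteq> {q \<in> positive_rvs. nonexplosive q}" using tilt by blast
  ultimately show ?thesis
    using Schroeder_Bernstein[of "\<lambda>q. q" "{q \<in> positive_rvs. nonexplosive q}" positive_rvs tilt] by auto
qed

theorem theorem5:
  shows "(\<forall>\<N>. regular_stopping_model \<N> \<longrightarrow>
            (can_include_N_I \<N> \<longleftrightarrow> is_pgf (phi \<N>) \<and> phi \<N> 0 = 0))
       \<and> (\<exists>\<Phi>. bij_betw \<Phi> full_models positive_rvs)
       \<and> (\<forall>\<N>\<in>full_models. phi_law \<N> \<in> positive_rvs \<and> (\<forall>t\<in>{0..<1}. pgf (phi_law \<N>) t = phi \<N> t))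
       \<and> bij_betw phi_law full_models {q \<in> positive_rvs. nonexplosive q}"
proof (intro conjI allI impI)
  fix \<N> assume "regular_stopping_model \<N>"
  then show "can_include_N_I \<N> \<longleftrightarrow> is_pgf (phi \<N>) \<and> phi \<N> 0 = 0"
    by (intro can_include_N_I_iff regular_stopping_model_nontrivial) (simp_all add: regular_stopping_model_def)
next
  \<comment> \<open>The witness is \<open>phi_law\<close> followed by the Schroeder-Bernstein
    bijection.\<close>
  show "\<exists>\<Phi>. bij_betw \<Phi> full_models positive_rvs"
    using ex_bij_nonexplosive bij_betw_trans[OF bij_betw_phi_law] by blast
next
  show "\<forall>\<N>\<in>full_models. phi_law \<N> \<in> positive_rvs \<and> (\<forall>t\<in>{0..<1}. pgf (phi_law \<N>) t = phi \<N> t)"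
    using phi_law_spec by simp
next
  show "bij_betw phi_law full_models {q \<in> positive_rvs. nonexplosive q}" by (rule bij_betw_phi_law)
qed

end
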